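(* Assume that the family of conformity scores $\mathfrak{C}$ is stable. (i) General case. The following two statements are equivalent: (G1) for all $\delta>0$ and all $\epsilon>0$, $\displaystyle\lim_{n\to\infty}\mathbb{P}\Big(\sup_{\alpha\in[0,1]}\big[\mathbb{P}(y_{n+1}\notin PS^{\mathrm{fc}}_{n,\alpha}(\delta)\,\|\,\mathcal{T}_n)-\alpha\big]\ge\epsilon\Big)=0$; (G2) for all $\delta>0$ and all $\epsilon>0$, $\displaystyle\lim_{n\to\infty}\mathbb{P}\Big(\sup_{\alpha\in[0,1]}\big[\mathbb{P}(y_{n+1}\notin PS^{\mathrm{sc}}_{n,\alpha}(\delta)\,\|\,\mathcal{T}_n)-\alpha\big]\ge\epsilon\Big)=0$. (ii) Continuous case. If, additionally, the continuous case assumption CC is fulfilled, then the following two statements are equivalent: (C1) $\displaystyle\lim_{n\to\infty}\mathbb{E}\Big(\sup_{\alpha\in[0,1]}\big|\mathbb{P}(y_{n+1}\notin PS^{\mathrm{fc}}_{n,\alpha}(0)\,\|\,\mathcal{T}_n)-\alpha\big|\Big)=0$; (C2) $\displaystyle\lim_{n\to\infty}\mathbb{E}\Big(\sup_{\alpha\in[0,1]}\big|\mathbb{P}(y_{n+1}\notin PS^{\mathrm{sc}}_{n,\alpha}(0)\,\|\,\mathcal{T}_n)-\alpha\big|\Big)=0$.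
   Context: Setting. For every $n\in\mathbb{N}$, $P_n$ is a regular Borel probability measure on $\mathcal{Z}_n=\mathcal{Y}_n\times\mathcal{X}_n$, where $\mathcal{Y}_n\subseteq\mathbb{R}$ is a (possibly unbounded) interval and $\mathcal{X}_n$ is a Euclidean space of dimension $p_n\in\mathbb{N}$. For each $n$, $t_i=t_i^{(n)}=(y_i,x_i)$, $1\le i\le n+1$, are i.i.d. with distribution $P_n$ (which may depend on $n$). Put $\mathcal{T}_n=(t_1,\dots,t_n)$, and let $\mathcal{T}_n^{\setminus i}$ denote $\mathcal{T}_n$ with $t_i$ removed. $\mathbb{P}(\cdot\,\|\,\mathcal{T}_n)$ denotes conditional probability given $\mathcal{T}_n$. Conformity scores. $\mathfrak{C}=(\mathcal{C}^{(n)}_m)_{n,m\in\mathbb{N}}$ is a family of measurable functions $\mathcal{C}^{(n)}_m:\mathcal{Z}_n\times\mathcal{Z}_n^m\to\mathbb{R}$ that are symmetric in their second argument (invariant under permutations of the $m$ entries); the superscript $(n)$ is dropped. $\mathfrak{C}$ is called stable if $|\mathcal{C}_n(t_{n+1},\mathcal{T}_n)-\mathcal{C}_{n-1}(t_{n+1},\mathcal{T}_n^{\setminus n})|\to 0$ in probability as $n\to\infty$. Continuous case assumption (CC): for every $n\in\mathbb{N}$ and almost every $\mathcal{T}_n$, the distribution of $\mathcal{C}_n(t_{n+1},\mathcal{T}_n)$ conditional on $\mathcal{T}_n$ is absolutely continuous with density $f_{\mathcal{T}_n}$, and the sequence of random variables $(\|f_{\mathcal{T}_n}\|_\infty)_{n\in\mathbb{N}}$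 is stochastically bounded, where $\|f\|_\infty=\sup_{x}|f(x)|$. Quantiles. For a cdf $F$ and $\alpha\in\mathbb{R}$, $F^{-1}(\alpha)=\inf\{x\in\mathbb{R}:F(x)\ge\alpha\}\in[-\infty,\infty]$ with $\inf\emptyset=+\infty$. For real $c$, $c\le+\infty$ is true and $c\le-\infty$ is false. Full conformal prediction sets. For $y\in\mathcal{Y}_n$ let $\mathcal{D}_{n+1}^y=(t_1,\dots,t_n,(y,x_{n+1}))$ and, for $s\in\mathbb{R}$, $$\hat F_y(s)=\frac{1}{n+1}\mathds{1}\{\mathcal{C}_n((y,x_{n+1}),\mathcal{T}_n)\le s\}+\frac1{n+1}\sum_{i=1}^n\mathds{1}\{\mathcal{C}_n(t_i,\mathcal{D}_{n+1}^y\setminus t_i)\le s\},$$ where $\mathcal{D}_{n+1}^y\setminus t_i$ is $\mathcal{D}_{n+1}^y$ with its $i$-th entry removed. For $\alpha,\delta\in\mathbb{R}$, $PS^{\mathrm{fc}}_{n,\alpha}(\delta)=\{y\in\mathcal{Y}_n:\mathcal{C}_n((y,x_{n+1}),\mathcal{T}_n)\le\hat F_y^{-1}(1-\alpha)+\delta\}$. Shortcut prediction sets. $PS^{\mathrm{sc}}_{n,\alpha}(\delta)=\{y\in\mathcal{Y}_n:\mathcal{C}_n((y,x_{n+1}),\mathcal{T}_n)\le\hat G^{-1}(1-\alpha)+\delta\}$, where $\hat G(s)=\frac1n\sum_{i=1}^n\mathds{1}\{\mathcal{C}_{n-1}(t_i,\mathcal{T}_n^{\setminus i})\le s\}$. 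*)

theory Defs
  imports "HOL-Probability.Probability" "HOL-Combinatorics.Permutations"
begin

text \<open>
  The dimension of the feature space varies with \<open>n\<close> inside a single statement, so \<open>\<real>\<^sup>p\<close> is the space of
  extensional functions on \<open>{1..p}\<close> and \<open>Z\<^sup>m\<close> the space of extensional functions on \<open>{1..m}\<close>, both
  with their product sigma-algebras. A data point is the pair \<open>(y, x)\<close>.
\<close>

type_synonym point = "real \<times> (nat \<Rightarrow> real)"

definition data_space :: "real set \<Rightarrow> nat \<Rightarrow> point measure" where
  "data_space Y p = restrict_space borel Y \<Otimes>\<^sub>M (\<Pi>\<^sub>M j\<in>{1..p}. borel)"

definition vectors :: "'a measure \<Rightarrow> nat \<Rightarrow> (nat \<Rightarrow> 'a) measure" where
  "vectors Z m = (\<Pi>\<^sub>M i\<in>{1..m}. Z)"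

text \<open>Compactness and openness refer to the subspace topology on the underlying set of \<open>M\<close>.\<close>

definition regular_measure :: "'a::topological_space measure \<Rightarrow> bool" where
  "regular_measure M \<longleftrightarrow> (\<forall>A\<in>sets M.
     emeasure M A = (SUP K\<in>{K \<in> sets M. K \<subseteq> A \<and> compact K}. emeasure M K) \<and>
     emeasure M A =
       (INF U\<in>{U \<in> sets M. A \<subseteq> U \<and> openin (top_of_set (space M)) U}. emeasure M U))"

text \<open>
  \<open>omit m i v\<close> deletes the \<open>i\<close>-th entry of \<open>v = (v\<^sub>1, \<dots>, v\<^sub>m)\<close>; the later entries move up by one place.
\<close>

definition omit :: "nat \<Rightarrow> nat \<Rightarrow> (nat \<Rightarrow> 'a) \<Rightarrow> nat \<Rightarrow> 'a" where
  "omit m i v = (\<lambda>j\<in>{1..m - 1}. v (if j < i then j else Suc j))"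

text \<open>
  For fixed \<open>n\<close>, a score family \<open>c\<close> maps \<open>m\<close> to the function \<open>c m\<close> on \<open>Z \<times> Z\<^sup>m\<close>.
\<close>

type_synonym scores = "nat \<Rightarrow> point \<Rightarrow> (nat \<Rightarrow> point) \<Rightarrow> real"

definition conformity_scores :: "point measure \<Rightarrow> scores \<Rightarrow> bool" where
  "conformity_scores Z c \<longleftrightarrow> (\<forall>m\<ge>1.
     (\<lambda>(z, v). c m z v) \<in> borel_measurable (Z \<Otimes>\<^sub>M vectors Z m) \<and>
     (\<forall>z\<in>space Z. \<forall>v\<in>space (vectors Z m). \<forall>\<pi>. \<pi> permutes {1..m} \<longrightarrow> c m z (v \<circ> \<pi>) = c m z v))"

definition quantile :: "(real \<Rightarrow> real) \<Rightarrow> real \<Rightarrow> ereal" where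
  "quantile F \<alpha> = Inf (ereal ` {x. F x \<ge> \<alpha>})"

definition F_fc :: "scores \<Rightarrow> nat \<Rightarrow> (nat \<Rightarrow> point) \<Rightarrow> (nat \<Rightarrow> real) \<Rightarrow> real \<Rightarrow> real \<Rightarrow> real" where
  "F_fc c n T x y s =
     1 / real (n + 1) * of_bool (c n (y, x) T \<le> s) +
     1 / real (n + 1) * (\<Sum>i=1..n. of_bool (c n (T i) (omit (n + 1) i (T(n + 1 := (y, x)))) \<le> s))"

definition PS_fc ::
  "real set \<Rightarrow> scores \<Rightarrow> nat \<Rightarrow> real \<Rightarrow> real \<Rightarrow> (nat \<Rightarrow> point) \<Rightarrow> (nat \<Rightarrow> real) \<Rightarrow> real set" where
  "PS_fc Y c n \<alpha> \<delta> T x =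
     {y \<in> Y. ereal (c n (y, x) T) \<le> quantile (F_fc c n T x y) (1 - \<alpha>) + ereal \<delta>}"

definition G_sc :: "scores \<Rightarrow> nat \<Rightarrow> (nat \<Rightarrow> point) \<Rightarrow> real \<Rightarrow> real" where
  "G_sc c n T s = 1 / real n * (\<Sum>i=1..n. of_bool (c (n - 1) (T i) (omit n i T) \<le> s))"

definition PS_sc ::
  "real set \<Rightarrow> scores \<Rightarrow> nat \<Rightarrow> real \<Rightarrow> real \<Rightarrow> (nat \<Rightarrow> point) \<Rightarrow> (nat \<Rightarrow> real) \<Rightarrow> real set" where
  "PS_sc Y c n \<alpha> \<delta> T x =
     {y \<in> Y. ereal (c n (y, x) T) \<le> quantile (G_sc c n T) (1 - \<alpha>) + ereal \<delta>}"

definition sample :: "(nat \<Rightarrow> 'w \<Rightarrow> point) \<Rightarrow> nat \<Rightarrow> 'w \<Rightarrow> nat \<Rightarrow> point" where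
  "sample t m \<omega> = (\<lambda>i\<in>{1..m}. t i \<omega>)"

definition stable ::
  "(nat \<Rightarrow> 'w measure) \<Rightarrow> (nat \<Rightarrow> nat \<Rightarrow> 'w \<Rightarrow> point) \<Rightarrow> (nat \<Rightarrow> scores) \<Rightarrow> bool" where
  "stable M t C \<longleftrightarrow> (\<forall>\<epsilon>>0.
     (\<lambda>n. measure (M n) {\<omega> \<in> space (M n).
        \<bar>C n n (t n (n + 1) \<omega>) (sample (t n) n \<omega>) -
         C n (n - 1) (t n (n + 1) \<omega>) (omit n n (sample (t n) n \<omega>))\<bar> \<ge> \<epsilon>}) \<longlonglongrightarrow> 0)"

text \<open>
  \<open>K\<close> is a regular version of the conditional distribution of \<open>X\<close> (with values in \<open>N\<close>) given the
  sub-sigma-algebra \<open>F\<close> of \<open>M\<close>. A regular version is needed because suprema over uncountably many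
  events are taken below.
\<close>

definition regular_cond_distr ::
  "'w measure \<Rightarrow> 'w measure \<Rightarrow> 'b measure \<Rightarrow> ('w \<Rightarrow> 'b) \<Rightarrow> ('w \<Rightarrow> 'b measure) \<Rightarrow> bool" where
  "regular_cond_distr M F N X K \<longleftrightarrow>
     K \<in> F \<rightarrow>\<^sub>M prob_algebra N \<and>
     (\<forall>B\<in>sets N. AE \<omega> in M.
        measure (K \<omega>) B = real_cond_exp M F (indicator (X -` B \<inter> space M)) \<omega>)"

text \<open>
  If \<open>k = K \<omega>\<close> is the conditional distribution of \<open>(t\<^sub>1, \<dots>, t\<^sub>n\<^sub>+\<^sub>1)\<close> given the training sample, then
  \<open>noncoverage k n S\<close> is the conditional probability, given the training sample, that \<open>y\<^sub>n\<^sub>+\<^sub>1\<close> is not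
  in the prediction set \<open>S\<close>, which is a function of the training sample and of \<open>x\<^sub>n\<^sub>+\<^sub>1\<close>.
\<close>

definition noncoverage ::
  "(nat \<Rightarrow> point) measure \<Rightarrow> nat \<Rightarrow> ((nat \<Rightarrow> point) \<Rightarrow> (nat \<Rightarrow> real) \<Rightarrow> real set) \<Rightarrow> real" where
  "noncoverage k n S =
     measure k {d \<in> space k. fst (d (n + 1)) \<notin> S (restrict d {1..n}) (snd (d (n + 1)))}"

text \<open>
  The supremum of the density is extended real valued, and stochastic boundedness is the usual
  \<open>O\<^sub>P(1)\<close>: for every \<open>\<epsilon> > 0\<close> there are \<open>B\<close> and \<open>n\<^sub>0\<close> with \<open>P(\<dots> > B) < \<epsilon>\<close> for all \<open>n \<ge> n\<^sub>0\<close>.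
\<close>

definition continuous_case ::
  "(nat \<Rightarrow> 'w measure) \<Rightarrow> (nat \<Rightarrow> nat \<Rightarrow> 'w \<Rightarrow> point) \<Rightarrow> (nat \<Rightarrow> scores) \<Rightarrow>
   (nat \<Rightarrow> 'w \<Rightarrow> (nat \<Rightarrow> point) measure) \<Rightarrow> bool" where
  "continuous_case M t C K \<longleftrightarrow> (\<exists>f :: nat \<Rightarrow> (nat \<Rightarrow> point) \<Rightarrow> real \<Rightarrow> real.
     let norm_f = (\<lambda>n \<omega>. SUP x. ereal \<bar>f n (sample (t n) n \<omega>) x\<bar>) in
     (\<forall>n\<ge>1. AE \<omega> in M n.
        (\<forall>x. 0 \<le> f n (sample (t n) n \<omega>) x) \<and>
        distributed (K n \<omega>) lborel (\<lambda>d. C n n (d (n + 1)) (restrict d {1..n}))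
          (\<lambda>x. ennreal (f n (sample (t n) n \<omega>) x))) \<and>
     (\<forall>n\<ge>1. norm_f n \<in> borel_measurable (M n)) \<and>
     (\<forall>\<epsilon>>0. \<exists>B::real. \<exists>n\<^sub>0. \<forall>n\<ge>n\<^sub>0.
        measure (M n) {\<omega> \<in> space (M n). norm_f n \<omega> > ereal B} < \<epsilon>))"

end

theory Submission
  imports Defs
begin

text \<open>
  The full conformal set compares the score of the test point with a quantile of the scores
  \<open>C\<^sub>n(t\<^sub>i, D \<setminus> t\<^sub>i)\<close>, and the shortcut set with a quantile of the scores \<open>C\<^sub>n\<^sub>-\<^sub>1(t\<^sub>i, T \<setminus> t\<^sub>i)\<close>. Stability says
  that adding one observation hardly changes the score of the test point. Since the observations are
  exchangeable, the same is true of each training point (\<open>prob_deviation\<close>), and by Markov's inequality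
  all but a proportion \<open>\<eta>\<close> of the training points have scores of both kinds that are less than \<open>\<epsilon>\<close>
  apart, except on an event of small probability (\<open>integral_K_bad_le\<close>).

  Off this event the two empirical distribution functions agree up to a horizontal shift by \<open>\<epsilon>\<close> and a
  vertical error \<open>\<kappa> = \<eta> + 1/n\<close> (\<open>ecdf_compare\<close>). Hence, if one of the sets with threshold inflation
  \<open>\<delta>\<close> and level \<open>\<alpha>\<close> misses the response, then so does the other one with inflation \<open>\<delta> - \<epsilon>\<close> and level
  \<open>\<alpha> + \<kappa>\<close> (\<open>miss_compare\<close>). The shift of the level costs at most \<open>\<kappa>\<close> in the supremum over all
  levels (\<open>SUP_excess_le\<close>, \<open>SUP_error_le\<close>). For the general case, \<open>\<epsilon> = \<delta>/2\<close> gives the equivalence.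

  In the continuous case there is no inflation to absorb the shift by \<open>\<epsilon>\<close>. Given the training sample,
  however, the shortcut quantile is a constant, so that moving the threshold of the shortcut set by
  \<open>\<epsilon>\<close> changes its noncoverage probability by at most \<open>\<epsilon>\<close> times the supremum of the density
  (\<open>miss_sc_shift\<close>). This suffices for both implications, because it is enough to move the threshold
  of the shortcut set.

  The suprema over all levels are measurable because noncoverage probabilities are step functions of
  the level that are continuous from the right (\<open>measurable_SUP\<close>). This matters because a
  nonmeasurable set has measure zero, and a nonmeasurable function has integral zero, by convention.
\<close>

section \<open>Empirical distribution functions and their quantiles\<close>

text \<open>The empirical distribution function of the sample \<open>a\<^sub>1, \<dots>, a\<^sub>m\<close>.\<close>

definition ecdf :: "nat \<Rightarrow> (nat \<Rightarrow> real) \<Rightarrow> real \<Rightarrow> real" where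
  "ecdf m a x = real (card {i \<in> {1..m}. a i \<le> x}) / real m"

text \<open>\<open>exceeds m a s u\<close> says that \<open>s\<close> is strictly larger than the \<open>u\<close>-quantile of the empirical
  distribution of \<open>a\<^sub>1, \<dots>, a\<^sub>m\<close>. This form avoids extended real quantiles: for \<open>u \<le> 0\<close> it is always
  true (the quantile is \<open>-\<infinity>\<close>) and for \<open>u > 1\<close> always false (the quantile is \<open>+\<infinity>\<close>).\<close>

definition exceeds :: "nat \<Rightarrow> (nat \<Rightarrow> real) \<Rightarrow> real \<Rightarrow> real \<Rightarrow> bool" where
  "exceeds m a s u \<longleftrightarrow> (\<exists>x<s. u \<le> ecdf m a x)"

lemma ecdf_mono: "x \<le> y \<Longrightarrow> ecdf m a x \<le> ecdf m a y"
  unfolding ecdf_def by (intro divide_right_mono of_nat_mono card_mono) auto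

lemma ecdf_nonneg: "0 \<le> ecdf m a x"
  by (simp add: ecdf_def)

lemma ecdf_range: "ecdf m a x \<in> (\<lambda>k. real k / real m) ` {..m}"
proof -
  have "card {i \<in> {1..m}. a i \<le> x} \<le> card {1..m}"
    by (rule card_mono) auto
  then show ?thesis
    unfolding ecdf_def by auto
qed

lemma ecdf_cong: "(\<And>i. i \<in> {1..m} \<Longrightarrow> a i = b i) \<Longrightarrow> ecdf m a x = ecdf m b x"
  unfolding ecdf_def by (intro arg_cong2[where f = "(/)"] arg_cong[where f = real] arg_cong[where f = card]) auto

lemma exceeds_cong: "(\<And>i. i \<in> {1..m} \<Longrightarrow> a i = b i) \<Longrightarrow> exceeds m a s u \<longleftrightarrow> exceeds m b s u"
  unfolding exceeds_def using ecdf_cong[of m a b] by simp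

lemma sum_of_bool_le_eq_ecdf:
  "1 / real m * (\<Sum>i=1..m. of_bool (a i \<le> x)) = ecdf m a x"
  unfolding ecdf_def by (simp add: Int_def)

lemma not_le_quantile_iff:
  "\<not> ereal s \<le> quantile F u + ereal \<delta> \<longleftrightarrow> (\<exists>x<s - \<delta>. u \<le> F x)"
proof -
  have "\<not> ereal s \<le> quantile F u + ereal \<delta> \<longleftrightarrow> quantile F u < ereal (s - \<delta>)"
    by (cases "quantile F u") auto
  also have "\<dots> \<longleftrightarrow> (\<exists>x<s - \<delta>. u \<le> F x)"
    unfolding quantile_def by (auto simp: Inf_less_iff)
  finally show ?thesis .
qed

lemma exceeds_iff_rat: "exceeds m a s u \<longleftrightarrow> (\<exists>q\<in>\<rat>. q < s \<and> u \<le> ecdf m a q)"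
proof
  assume "exceeds m a s u"
  then obtain x where x: "x < s" "u \<le> ecdf m a x"
    unfolding exceeds_def by auto
  then obtain q where "q \<in> \<rat>" "x < q" "q < s"
    using Rats_dense_in_real by blast
  moreover have "u \<le> ecdf m a q"
    using x ecdf_mono[of x q m a] \<open>x < q\<close> by simp
  ultimately show "\<exists>q\<in>\<rat>. q < s \<and> u \<le> ecdf m a q"
    by blast
qed (auto simp: exceeds_def)

lemma exceeds_nonpos: "u \<le> 0 \<Longrightarrow> exceeds m a s u"
  unfolding exceeds_def using ecdf_nonneg[of m a "s - 1"]
  by (intro exI[of _ "s - 1"]) auto

text \<open>An empirical distribution function takes finitely many values, so the event in question is
  locally constant to the left of each level, uniformly in the sample.\<close>

lemma exceeds_locally_constant:
  "\<exists>\<eta>>0. \<forall>v. u - \<eta> < v \<longrightarrow> v \<le> u \<longrightarrow> (\<forall>a s. exceeds m a s v = exceeds m a s u)"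
proof -
  define V where "V = (\<lambda>k. real k / real m) ` {..m}"
  have fin: "finite {v \<in> V. v < u}"
    unfolding V_def by simp
  obtain \<eta> where \<eta>: "\<eta> > 0" "\<forall>v\<in>V. v < u \<longrightarrow> v \<le> u - \<eta>"
  proof (cases "{v \<in> V. v < u} = {}")
    case True
    then show ?thesis
      using that[of 1] by auto
  next
    case False
    have "Max {v \<in> V. v < u} < u"
      using Max_in[OF fin False] by blast
    moreover have "\<forall>v\<in>V. v < u \<longrightarrow> v \<le> Max {v \<in> V. v < u}"
      using Max_ge[OF fin] by blast
    ultimately show ?thesis
      using that[of "u - Max {v \<in> V. v < u}"] by auto
  qed
  have "v \<le> ecdf m a x \<longleftrightarrow> u \<le> ecdf m a x" if "u - \<eta> < v" "v \<le> u" for v a x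
    using \<eta>(2) ecdf_range[of m a x] that unfolding V_def[symmetric] by force
  then show ?thesis
    using \<eta>(1) unfolding exceeds_def by blast
qed

lemma measurable_exceeds:
  assumes "\<And>i. i \<in> {1..m} \<Longrightarrow> (\<lambda>d. a d i) \<in> borel_measurable N" and [measurable]: "s \<in> borel_measurable N"
  shows "{d \<in> space N. exceeds m (a d) (s d) u} \<in> sets N"
proof -
  have [measurable]: "(\<lambda>d. ecdf m (a d) x) \<in> borel_measurable N" for x
    unfolding sum_of_bool_le_eq_ecdf[symmetric] using assms(1) by measurable
  have "countable (\<rat> :: real set)"
    by (rule countable_rat)
  then have "Measurable.pred N (\<lambda>d. \<exists>q\<in>\<rat>. q < s d \<and> u \<le> ecdf m (a d) q)"
    by measurable
  then show ?thesis
    unfolding exceeds_iff_rat by simp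
qed

text \<open>If two samples differ by \<open>\<epsilon>\<close> or more in at most \<open>n \<eta>\<close> of their first \<open>n\<close> entries, then their
  empirical distribution functions agree up to a horizontal shift by \<open>\<epsilon>\<close> and a vertical error
  \<open>\<eta> + 1/n\<close>. The summand \<open>1/n\<close> pays for the additional entry \<open>a\<^sub>n\<^sub>+\<^sub>1\<close> of one of the samples.\<close>

lemma ecdf_compare:
  assumes n: "n \<ge> 1" and dev: "real (card {i \<in> {1..n}. \<epsilon> \<le> \<bar>a i - b i\<bar>}) \<le> real n * \<eta>"
  shows "ecdf n b x \<le> ecdf (n + 1) a (x + \<epsilon>) + (\<eta> + 1 / real n)"
    and "ecdf (n + 1) a x \<le> ecdf n b (x + \<epsilon>) + (\<eta> + 1 / real n)"
proof -
  define D where "D = {i \<in> {1..n}. \<epsilon> \<le> \<bar>a i - b i\<bar>}"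
  have D: "real (card D) / n \<le> \<eta>" "finite D"
    using dev n by (auto simp: D_def field_simps)
  have "card {i \<in> {1..n}. b i \<le> x} \<le> card ({i \<in> {1..n+1}. a i \<le> x + \<epsilon>} \<union> D)"
    by (rule card_mono) (auto simp: D_def)
  also have "\<dots> \<le> card {i \<in> {1..n+1}. a i \<le> x + \<epsilon>} + card D"
    by (rule card_Un_le)
  finally have 1: "real (card {i \<in> {1..n}. b i \<le> x}) \<le> real (card {i \<in> {1..n+1}. a i \<le> x + \<epsilon>}) + card D"
    by linarith
  have 2: "card {i \<in> {1..n+1}. a i \<le> x + \<epsilon>} \<le> n + 1"
    using card_mono[of "{1..n+1}" "{i \<in> {1..n+1}. a i \<le> x + \<epsilon>}"] by fastforce
  have "real k / n = real k / real (n + 1) + real k / real (n + 1) / n" for k :: nat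
    using n by (simp add: divide_simps) (simp add: algebra_simps)
  moreover have "ecdf (n + 1) a (x + \<epsilon>) / n \<le> 1 / n"
    unfolding ecdf_def using 2 by (intro divide_right_mono) auto
  ultimately have "real (card {i \<in> {1..n+1}. a i \<le> x + \<epsilon>}) / n \<le> ecdf (n + 1) a (x + \<epsilon>) + 1 / n"
    unfolding ecdf_def by simp
  then show "ecdf n b x \<le> ecdf (n + 1) a (x + \<epsilon>) + (\<eta> + 1 / real n)"
    using divide_right_mono[OF 1, of "real n"] D(1) unfolding ecdf_def[of n] add_divide_distrib by linarith
  have "card {i \<in> {1..n+1}. a i \<le> x} \<le> card ({i \<in> {1..n}. b i \<le> x + \<epsilon>} \<union> D \<union> {n + 1})"
    by (rule card_mono) (auto simp: D_def)
  also have "\<dots> \<le> card {i \<in> {1..n}. b i \<le> x + \<epsilon>} + card D + card {n + 1}"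
    using card_Un_le[of "{i \<in> {1..n}. b i \<le> x + \<epsilon>} \<union> D" "{n + 1}"]
      card_Un_le[of "{i \<in> {1..n}. b i \<le> x + \<epsilon>}" D] by linarith
  finally have 3: "real (card {i \<in> {1..n+1}. a i \<le> x}) \<le> real (card {i \<in> {1..n}. b i \<le> x + \<epsilon>}) + card D + 1"
    by simp
  have "ecdf (n + 1) a x \<le> real (card {i \<in> {1..n+1}. a i \<le> x}) / n"
    unfolding ecdf_def using n by (intro divide_left_mono) auto
  then show "ecdf (n + 1) a x \<le> ecdf n b (x + \<epsilon>) + (\<eta> + 1 / real n)"
    using divide_right_mono[OF 3, of "real n"] D(1) unfolding ecdf_def[of n] add_divide_distrib by linarith
qed

lemma exceeds_compare:
  assumes "n \<ge> 1" and "real (card {i \<in> {1..n}. \<epsilon> \<le> \<bar>a i - b i\<bar>}) \<le> real n * \<eta>"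
  shows "exceeds n b s u \<Longrightarrow> exceeds (n + 1) a (s + \<epsilon>) (u - (\<eta> + 1 / real n))"
    and "exceeds (n + 1) a s u \<Longrightarrow> exceeds n b (s + \<epsilon>) (u - (\<eta> + 1 / real n))"
proof -
  show "exceeds (n + 1) a (s + \<epsilon>) (u - (\<eta> + 1 / real n))" if "exceeds n b s u"
  proof -
    from that obtain x where "x < s" "u \<le> ecdf n b x"
      by (auto simp: exceeds_def)
    then show ?thesis
      unfolding exceeds_def using ecdf_compare(1)[OF assms, of x]
      by (intro exI[of _ "x + \<epsilon>"]) auto
  qed
  show "exceeds n b (s + \<epsilon>) (u - (\<eta> + 1 / real n))" if "exceeds (n + 1) a s u"
  proof -
    from that obtain x where "x < s" "u \<le> ecdf (n + 1) a x"
      by (auto simp: exceeds_def)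
    then show ?thesis
      unfolding exceeds_def using ecdf_compare(2)[OF assms, of x]
      by (intro exI[of _ "x + \<epsilon>"]) auto
  qed
qed

text \<open>The scores \<open>s\<close> whose comparison with the quantile is changed by adding \<open>\<epsilon>\<close> lie in an interval of
  length \<open>\<epsilon>\<close> that ends in the quantile. If the quantile is infinite, there are none, and \<open>q\<close> is
  arbitrary.\<close>

lemma exceeds_diff_interval:
  assumes \<epsilon>: "\<epsilon> \<ge> 0"
  shows "\<exists>q. \<forall>s. exceeds m a (s + \<epsilon>) u \<longrightarrow> \<not> exceeds m a s u \<longrightarrow> s \<in> {q - \<epsilon>..q}"
proof (cases "{x. u \<le> ecdf m a x} \<noteq> {} \<and> bdd_below {x. u \<le> ecdf m a x}")
  case True
  define q where "q = Inf {x. u \<le> ecdf m a x}"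
  have "s \<le> q" if "\<not> exceeds m a s u" for s
    unfolding q_def using True that by (intro cInf_greatest) (auto simp: exceeds_def not_less[symmetric])
  moreover have "q - \<epsilon> \<le> s" if ex: "exceeds m a (s + \<epsilon>) u" for s
  proof -
    obtain x where "x < s + \<epsilon>" "u \<le> ecdf m a x"
      using ex by (auto simp: exceeds_def)
    moreover from this have "q \<le> x"
      unfolding q_def using True by (intro cInf_lower) auto
    ultimately show ?thesis by simp
  qed
  ultimately show ?thesis by auto
next
  case False
  then consider "\<forall>x. \<not> u \<le> ecdf m a x" | "\<not> bdd_below {x. u \<le> ecdf m a x}"
    by blast
  then show ?thesis
  proof cases
    case 1
    then show ?thesis by (auto simp: exceeds_def)
  next
    case 2
    then have "exceeds m a s u" for s
      unfolding exceeds_def bdd_below_def by (metis mem_Collect_eq not_le)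
    then show ?thesis by auto
  qed
qed

lemma real_eq_if_same_rat_upper:
  fixes x y :: real
  assumes "\<And>q. q \<in> \<rat> \<Longrightarrow> x \<le> q \<longleftrightarrow> y \<le> q"
  shows "x = y"
proof (rule ccontr)
  assume "x \<noteq> y"
  then consider "x < y" | "y < x" by linarith
  then show False
  proof cases
    case 1
    then obtain q where "q \<in> \<rat>" "x < q" "q < y" using Rats_dense_in_real by blast
    then show False using assms[of q] by auto
  next
    case 2
    then obtain q where "q \<in> \<rat>" "y < q" "q < x" using Rats_dense_in_real by blast
    then show False using assms[of q] by auto
  qed
qed

section \<open>Suprema over the nominal level\<close>

text \<open>A noncoverage function \<open>N1\<close> that is bounded by \<open>N2\<close> after a shift of the level by \<open>\<kappa>\<close> exceeds the
  nominal level by hardly more than \<open>N2\<close> does. If the shifted level leaves the unit interval, then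
  the excess at the original level is below \<open>\<kappa>\<close>, and \<open>N2 1 = 1\<close> makes the right-hand supremum
  nonnegative.\<close>

lemma SUP_excess_le:
  fixes N1 N2 :: "real \<Rightarrow> real"
  assumes N1: "\<And>\<alpha>. N1 \<alpha> \<le> 1" and N2: "\<And>\<alpha>. N2 \<alpha> \<le> 1"
    and one: "N2 1 = 1" and \<kappa>: "\<kappa> \<ge> 0" and r: "r \<ge> 0"
    and le: "\<And>\<alpha>. N1 \<alpha> \<le> N2 (\<alpha> + \<kappa>) + r"
  shows "(SUP \<alpha>\<in>{0..1}. N1 \<alpha> - \<alpha>) \<le> (SUP \<alpha>\<in>{0..1}. N2 \<alpha> - \<alpha>) + \<kappa> + r"
proof (rule cSUP_least)
  have "N2 \<alpha> - \<alpha> \<le> 1" if "\<alpha> \<in> {0..1}" for \<alpha>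
    using N2[of \<alpha>] that by auto
  then have bdd: "bdd_above ((\<lambda>\<alpha>. N2 \<alpha> - \<alpha>) ` {0..1})"
    by (intro bdd_aboveI[of _ 1]) auto
  fix \<alpha> :: real assume \<alpha>: "\<alpha> \<in> {0..1}"
  show "N1 \<alpha> - \<alpha> \<le> (SUP \<alpha>\<in>{0..1}. N2 \<alpha> - \<alpha>) + \<kappa> + r"
  proof (cases "\<alpha> + \<kappa> \<le> 1")
    case True
    then have "N2 (\<alpha> + \<kappa>) - (\<alpha> + \<kappa>) \<le> (SUP \<alpha>\<in>{0..1}. N2 \<alpha> - \<alpha>)"
      using \<alpha> \<kappa> by (intro cSUP_upper[OF _ bdd]) auto
    then show ?thesis using le[of \<alpha>] by linarith
  next
    case False
    have "N2 1 - 1 \<le> (SUP \<alpha>\<in>{0..1}. N2 \<alpha> - \<alpha>)"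
      by (intro cSUP_upper[OF _ bdd]) auto
    then show ?thesis using False N1[of \<alpha>] one r by linarith
  qed
qed auto

lemma SUP_error_le:
  fixes N1 N2 :: "real \<Rightarrow> real"
  assumes N1: "\<And>\<alpha>. 0 \<le> N1 \<alpha>" "\<And>\<alpha>. N1 \<alpha> \<le> 1" and N2: "\<And>\<alpha>. 0 \<le> N2 \<alpha>" "\<And>\<alpha>. N2 \<alpha> \<le> 1"
    and \<kappa>: "\<kappa> \<ge> 0" and r: "r \<ge> 0"
    and le: "\<And>\<alpha>. N1 \<alpha> \<le> N2 (\<alpha> + \<kappa>) + r" and ge: "\<And>\<alpha>. N2 \<alpha> \<le> N1 (\<alpha> + \<kappa>) + r"
  shows "(SUP \<alpha>\<in>{0..1}. \<bar>N1 \<alpha> - \<alpha>\<bar>) \<le> (SUP \<alpha>\<in>{0..1}. \<bar>N2 \<alpha> - \<alpha>\<bar>) + \<kappa> + r"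
proof (rule cSUP_least)
  have "\<bar>N2 \<alpha> - \<alpha>\<bar> \<le> 1" if "\<alpha> \<in> {0..1}" for \<alpha>
    using N2[of \<alpha>] that by auto
  then have "bdd_above ((\<lambda>\<alpha>. \<bar>N2 \<alpha> - \<alpha>\<bar>) ` {0..1})"
    by (intro bdd_aboveI[of _ 1]) auto
  then have up: "\<bar>N2 \<alpha> - \<alpha>\<bar> \<le> (SUP \<alpha>\<in>{0..1}. \<bar>N2 \<alpha> - \<alpha>\<bar>)" if "\<alpha> \<in> {0..1}" for \<alpha>
    using that by (intro cSUP_upper)
  have pos: "0 \<le> (SUP \<alpha>\<in>{0..1}. \<bar>N2 \<alpha> - \<alpha>\<bar>)"
    using up[of 0] by auto
  fix \<alpha> :: real assume \<alpha>: "\<alpha> \<in> {0..1}"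
  have "N1 \<alpha> - \<alpha> \<le> (SUP \<alpha>\<in>{0..1}. \<bar>N2 \<alpha> - \<alpha>\<bar>) + \<kappa> + r"
  proof (cases "\<alpha> + \<kappa> \<le> 1")
    case True
    then show ?thesis using up[of "\<alpha> + \<kappa>"] \<alpha> \<kappa> le[of \<alpha>] by auto
  next
    case False
    then show ?thesis using N1(2)[of \<alpha>] pos r by linarith
  qed
  moreover have "\<alpha> - N1 \<alpha> \<le> (SUP \<alpha>\<in>{0..1}. \<bar>N2 \<alpha> - \<alpha>\<bar>) + \<kappa> + r"
  proof (cases "\<alpha> - \<kappa> \<ge> 0")
    case True
    then show ?thesis using up[of "\<alpha> - \<kappa>"] \<alpha> \<kappa> ge[of "\<alpha> - \<kappa>"] by auto
  next
    case False
    then show ?thesis using N1(1)[of \<alpha>] pos r by linarith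
  qed
  ultimately show "\<bar>N1 \<alpha> - \<alpha>\<bar> \<le> (SUP \<alpha>\<in>{0..1}. \<bar>N2 \<alpha> - \<alpha>\<bar>) + \<kappa> + r"
    by linarith
qed auto

lemma SUP_abs_unit:
  fixes N :: "real \<Rightarrow> real"
  assumes "\<And>\<alpha>. 0 \<le> N \<alpha>" "\<And>\<alpha>. N \<alpha> \<le> 1"
  shows "(SUP \<alpha>\<in>{0..1}. \<bar>N \<alpha> - \<alpha>\<bar>) \<in> {0..1}"
proof -
  have le: "\<bar>N \<alpha> - \<alpha>\<bar> \<le> 1" if "\<alpha> \<in> {0..1}" for \<alpha>
    using assms[of \<alpha>] that by auto
  then have "bdd_above ((\<lambda>\<alpha>. \<bar>N \<alpha> - \<alpha>\<bar>) ` {0..1})"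
    by (intro bdd_aboveI[of _ 1]) auto
  then have "\<bar>N 0 - 0\<bar> \<le> (SUP \<alpha>\<in>{0..1}. \<bar>N \<alpha> - \<alpha>\<bar>)"
    by (intro cSUP_upper) auto
  moreover have "(SUP \<alpha>\<in>{0..1}. \<bar>N \<alpha> - \<alpha>\<bar>) \<le> 1"
    using le by (intro cSUP_least) auto
  ultimately show ?thesis by auto
qed

text \<open>For a function that is continuous from the right, countably many levels suffice for the supremum.\<close>

lemma SUP_unit_interval_eq_SUP_rats:
  fixes h :: "real \<Rightarrow> real"
  assumes bdd: "\<And>\<alpha>. \<alpha> \<in> {0..1} \<Longrightarrow> h \<alpha> \<le> B"
    and cont: "\<And>\<alpha>. 0 \<le> \<alpha> \<Longrightarrow> \<alpha> < 1 \<Longrightarrow> (h \<longlongrightarrow> h \<alpha>) (at_right \<alpha>)"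
  shows "(SUP \<alpha>\<in>{0..1}. h \<alpha>) = (SUP \<alpha>\<in>{0..1} \<inter> \<rat>. h \<alpha>)"
proof (rule antisym)
  have b: "bdd_above (h ` {0..1})" "bdd_above (h ` ({0..1} \<inter> \<rat>))"
    using bdd by (auto intro!: bdd_aboveI[of _ B])
  have ne: "{0..1::real} \<inter> \<rat> \<noteq> {}"
    using Rats_0 by fastforce
  show "(SUP \<alpha>\<in>{0..1} \<inter> \<rat>. h \<alpha>) \<le> (SUP \<alpha>\<in>{0..1}. h \<alpha>)"
    by (rule cSUP_subset_mono[OF ne b(1)]) auto
  have up: "h q \<le> (SUP \<alpha>\<in>{0..1} \<inter> \<rat>. h \<alpha>)" if "q \<in> {0..1} \<inter> \<rat>" for q
    using that b(2) by (rule cSUP_upper)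
  show "(SUP \<alpha>\<in>{0..1}. h \<alpha>) \<le> (SUP \<alpha>\<in>{0..1} \<inter> \<rat>. h \<alpha>)"
  proof (rule cSUP_least)
    fix \<alpha> :: real assume \<alpha>: "\<alpha> \<in> {0..1}"
    show "h \<alpha> \<le> (SUP \<alpha>\<in>{0..1} \<inter> \<rat>. h \<alpha>)"
    proof (cases "\<alpha> = 1")
      case True
      then show ?thesis using up[of 1] by auto
    next
      case False
      then have \<alpha>': "0 \<le> \<alpha>" "\<alpha> < 1" using \<alpha> by auto
      show ?thesis
      proof (rule ccontr)
        assume "\<not> ?thesis"
        then have "\<forall>\<^sub>F x in at_right \<alpha>. (SUP \<alpha>\<in>{0..1} \<inter> \<rat>. h \<alpha>) < h x"
          using order_tendstoD(1)[OF cont[OF \<alpha>']] by (simp add: not_le)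
        then obtain b where b: "b > \<alpha>" "\<And>x. \<alpha> < x \<Longrightarrow> x < b \<Longrightarrow> (SUP \<alpha>\<in>{0..1} \<inter> \<rat>. h \<alpha>) < h x"
          unfolding eventually_at_right_field by blast
        obtain q where "q \<in> \<rat>" "\<alpha> < q" "q < min b 1"
          using Rats_dense_in_real[of \<alpha> "min b 1"] b \<alpha>' by auto
        then show False
          using b(2)[of q] up[of q] \<alpha>' by auto
      qed
    qed
  qed auto
qed

section \<open>The sample as a point of the product space\<close>

text \<open>The setting for one sample size \<open>n\<close>. As \<open>n \<ge> 2\<close>, the leave-one-out scores use samples of positive
  size \<open>n - 1\<close>.\<close>

locale conformal_sample = prob_space M
  for M :: "'w measure" +
  fixes n :: nat and Y :: "real set" and p :: nat and P :: "point measure"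
    and t :: "nat \<Rightarrow> 'w \<Rightarrow> point" and c :: scores and K :: "'w \<Rightarrow> (nat \<Rightarrow> point) measure"
  assumes n: "n \<ge> 2"
    and P: "prob_space P"
    and sets_P: "sets P = sets (data_space Y p)"
    and indep: "indep_vars (\<lambda>_. data_space Y p) t {1..n + 1}"
    and distr_t: "\<And>i. i \<in> {1..n + 1} \<Longrightarrow> distr M (data_space Y p) (t i) = P"
    and scores: "conformity_scores (data_space Y p) c"
    and cond: "regular_cond_distr M
        (vimage_algebra (space M) (sample t n) (vectors (data_space Y p) n))
        (vectors (data_space Y p) (n + 1)) (sample t (n + 1)) K"
begin

\<comment> \<open>Keeps indices in the form \<open>n + 1\<close> in which the sample spaces are indexed.\<close>
declare One_nat_def [simp del]

abbreviation Z :: "point measure" where "Z \<equiv> data_space Y p"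

abbreviation V :: "nat \<Rightarrow> (nat \<Rightarrow> point) measure" where "V m \<equiv> vectors Z m"

text \<open>The sigma-algebra generated by the training sample.\<close>

abbreviation F :: "'w measure" where
  "F \<equiv> vimage_algebra (space M) (sample t n) (V n)"

text \<open>The two kinds of scores as functions of the whole sample \<open>d = (t\<^sub>1, \<dots>, t\<^sub>n\<^sub>+\<^sub>1)\<close>. The full conformal
  scores are those at the true response \<open>y = y\<^sub>n\<^sub>+\<^sub>1\<close>; since deleting the last entry leaves the training
  sample, \<open>fc_score d (n + 1)\<close> is the score of the test point. The shortcut scores are the
  leave-one-out scores of the training sample.\<close>

definition fc_score :: "(nat \<Rightarrow> point) \<Rightarrow> nat \<Rightarrow> real" where
  "fc_score d i = c n (d i) (omit (n + 1) i d)"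

definition sc_score :: "(nat \<Rightarrow> point) \<Rightarrow> nat \<Rightarrow> real" where
  "sc_score d i = c (n - 1) (d i) (omit n i (restrict d {1..n}))"

text \<open>The events that \<open>y\<^sub>n\<^sub>+\<^sub>1\<close> is missed by the full conformal and by the shortcut prediction set.\<close>

definition miss_fc :: "real \<Rightarrow> real \<Rightarrow> (nat \<Rightarrow> point) set" where
  "miss_fc \<delta> \<alpha> =
     {d \<in> space (V (n + 1)). exceeds (n + 1) (fc_score d) (fc_score d (n + 1) - \<delta>) (1 - \<alpha>)}"

definition miss_sc :: "real \<Rightarrow> real \<Rightarrow> (nat \<Rightarrow> point) set" where
  "miss_sc \<delta> \<alpha> =
     {d \<in> space (V (n + 1)). exceeds n (sc_score d) (fc_score d (n + 1) - \<delta>) (1 - \<alpha>)}"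

text \<open>The event that a proportion of more than \<open>\<eta>\<close> of the training points have full conformal and shortcut
  scores that are at least \<open>\<epsilon>\<close> apart.\<close>

definition bad :: "real \<Rightarrow> real \<Rightarrow> (nat \<Rightarrow> point) set" where
  "bad \<epsilon> \<eta> = {d \<in> space (V (n + 1)).
     real n * \<eta> < real (card {i \<in> {1..n}. \<epsilon> \<le> \<bar>fc_score d i - sc_score d i\<bar>})}"

section \<open>Measurability\<close>

lemma measurable_component: "i \<in> {1..m} \<Longrightarrow> (\<lambda>d. d i) \<in> V m \<rightarrow>\<^sub>M Z"
  unfolding vectors_def by (rule measurable_component_singleton)

lemma measurable_omit: "omit (m + 1) i \<in> V (m + 1) \<rightarrow>\<^sub>M V m"
proof -
  have "(\<lambda>v. \<lambda>j\<in>{1..m}. v (if j < i then j else Suc j)) \<in> V (m + 1) \<rightarrow>\<^sub>M V m"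
    unfolding vectors_def by (intro measurable_restrict measurable_component_singleton) auto
  then show ?thesis
    unfolding omit_def by simp
qed

lemma measurable_restrict_vectors: "m \<le> l \<Longrightarrow> (\<lambda>d. restrict d {1..m}) \<in> V l \<rightarrow>\<^sub>M V m"
  unfolding vectors_def by (rule measurable_restrict_subset) auto

lemma measurable_score:
  assumes "m \<ge> 1" "f \<in> N \<rightarrow>\<^sub>M Z" "g \<in> N \<rightarrow>\<^sub>M V m"
  shows "(\<lambda>d. c m (f d) (g d)) \<in> borel_measurable N"
proof -
  have "(\<lambda>(z, v). c m z v) \<in> borel_measurable (Z \<Otimes>\<^sub>M V m)"
    using scores \<open>m \<ge> 1\<close> unfolding conformity_scores_def by blast
  from measurable_compose[OF measurable_Pair[OF assms(2,3)] this] show ?thesis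
    by simp
qed

lemma measurable_fc_score:
  assumes "i \<in> {1..n + 1}"
  shows "(\<lambda>d. fc_score d i) \<in> borel_measurable (V (n + 1))"
  unfolding fc_score_def using n assms
  by (intro measurable_score measurable_component measurable_omit) auto

lemma measurable_loo_score:
  assumes "i \<in> {1..n}"
  shows "(\<lambda>d. c (n - 1) (d i) (omit n i d)) \<in> borel_measurable (V n)"
proof -
  have "omit (n - 1 + 1) i \<in> V (n - 1 + 1) \<rightarrow>\<^sub>M V (n - 1)"
    by (rule measurable_omit)
  then have "omit n i \<in> V n \<rightarrow>\<^sub>M V (n - 1)"
    using n by simp
  then show ?thesis
    using n assms by (intro measurable_score measurable_component) auto
qed

lemma sc_score_restrict:
  "i \<in> {1..n} \<Longrightarrow> sc_score d i = c (n - 1) (restrict d {1..n} i) (omit n i (restrict d {1..n}))"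
  by (simp add: sc_score_def)

lemma measurable_sc_score:
  assumes "i \<in> {1..n}"
  shows "(\<lambda>d. sc_score d i) \<in> borel_measurable (V (n + 1))"
proof -
  have "(\<lambda>d. c (n - 1) (restrict d {1..n} i) (omit n i (restrict d {1..n}))) \<in> borel_measurable (V (n + 1))"
    by (rule measurable_compose[OF measurable_restrict_vectors measurable_loo_score[OF assms]]) simp
  then show ?thesis
    using sc_score_restrict[OF assms] by simp
qed

lemma sets_miss_fc: "miss_fc \<delta> \<alpha> \<in> sets (V (n + 1))"
  unfolding miss_fc_def
  by (rule measurable_exceeds) (auto intro!: borel_measurable_diff measurable_fc_score)

lemma sets_miss_sc: "miss_sc \<delta> \<alpha> \<in> sets (V (n + 1))"
  unfolding miss_sc_def
  by (rule measurable_exceeds) (auto intro!: borel_measurable_diff measurable_fc_score measurable_sc_score)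

lemma measurable_deviation_count:
  "(\<lambda>d. real (card {i \<in> {1..n}. \<epsilon> \<le> \<bar>fc_score d i - sc_score d i\<bar>})) \<in> borel_measurable (V (n + 1))"
proof -
  have [measurable]: "(\<lambda>d. fc_score d i) \<in> borel_measurable (V (n + 1))"
      "(\<lambda>d. sc_score d i) \<in> borel_measurable (V (n + 1))" if "i \<in> {1..n}" for i
    using that by (auto intro: measurable_fc_score measurable_sc_score)
  have "(\<lambda>d. \<Sum>i=1..n. of_bool (\<epsilon> \<le> \<bar>fc_score d i - sc_score d i\<bar>) :: real) \<in> borel_measurable (V (n + 1))"
    by measurable
  then show ?thesis
    by (simp add: Int_def)
qed

lemma sets_bad: "bad \<epsilon> \<eta> \<in> sets (V (n + 1))"
  unfolding bad_def using measurable_deviation_count[of \<epsilon>] by measurable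

lemma measurable_t: "i \<in> {1..n + 1} \<Longrightarrow> t i \<in> M \<rightarrow>\<^sub>M Z"
  using indep by (auto simp: indep_vars_def)

lemma measurable_sample: "m \<le> n + 1 \<Longrightarrow> sample t m \<in> M \<rightarrow>\<^sub>M V m"
  unfolding sample_def vectors_def
  by (intro measurable_restrict measurable_t) auto

lemma subalgebra_F: "subalgebra M F"
  unfolding subalgebra_def
  using measurable_sample[of n] by (auto simp: sets_vimage_algebra2 measurable_space measurable_sets)

sublocale F: finite_measure_subalgebra M F
  by unfold_locales (rule subalgebra_F)

lemma K_measurable: "K \<in> M \<rightarrow>\<^sub>M prob_algebra (V (n + 1))"
  using cond subalgebra_F unfolding regular_cond_distr_def by (blast intro: measurable_from_subalg)

lemma K:
  assumes "\<omega> \<in> space M"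
  shows "prob_space (K \<omega>)" "sets (K \<omega>) = sets (V (n + 1))" "space (K \<omega>) = space (V (n + 1))"
proof -
  have "K \<omega> \<in> space (prob_algebra (V (n + 1)))"
    using measurable_space[OF K_measurable assms] .
  then show "prob_space (K \<omega>)" and s: "sets (K \<omega>) = sets (V (n + 1))"
    by (auto simp: space_prob_algebra)
  show "space (K \<omega>) = space (V (n + 1))"
    using sets_eq_imp_space_eq[OF s] .
qed

lemma measurable_K_measure [measurable]:
  "B \<in> sets (V (n + 1)) \<Longrightarrow> (\<lambda>\<omega>. measure (K \<omega>) B) \<in> borel_measurable M"
  by (rule measurable_compose[OF K_measurable measurable_measure_prob_algebra])

lemma K_measure_le_1: "\<omega> \<in> space M \<Longrightarrow> measure (K \<omega>) B \<le> 1"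
  using K(1) prob_space.prob_le_1 by blast

section \<open>Noncoverage as the probability of an event\<close>

lemma omit_last: "omit (n + 1) (n + 1) d = restrict d {1..n}"
  unfolding omit_def by (auto simp: restrict_def fun_eq_iff)

lemma in_space_V: "d \<in> space (V m) \<Longrightarrow> i \<in> {1..m} \<Longrightarrow> d i \<in> space Z"
  using measurable_space[OF measurable_component] .

lemma fst_mem_Y: "z \<in> space Z \<Longrightarrow> fst z \<in> Y"
  by (auto simp: data_space_def space_pair_measure space_restrict_space)

lemma restrict_upd_last:
  assumes "d \<in> space (V (n + 1))"
  shows "(restrict d {1..n})(n + 1 := d (n + 1)) = d"
proof
  fix i
  show "((restrict d {1..n})(n + 1 := d (n + 1))) i = d i"
    using assms by (auto simp: vectors_def space_PiM PiE_def extensional_def)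
qed

lemma F_fc_eq_ecdf:
  assumes "d \<in> space (V (n + 1))"
  shows "F_fc c n (restrict d {1..n}) (snd (d (n + 1))) (fst (d (n + 1))) x = ecdf (n + 1) (fc_score d) x"
  unfolding F_fc_def sum_of_bool_le_eq_ecdf[symmetric]
  using restrict_upd_last[OF assms] omit_last[of d]
  by (simp add: fc_score_def distrib_left sum.nat_ivl_Suc' flip: Suc_eq_plus1 del: sum_of_bool_eq)

lemma noncoverage_fc:
  assumes "\<omega> \<in> space M"
  shows "noncoverage (K \<omega>) n (PS_fc Y c n \<alpha> \<delta>) = measure (K \<omega>) (miss_fc \<delta> \<alpha>)"
proof -
  have "fst (d (n + 1)) \<notin> PS_fc Y c n \<alpha> \<delta> (restrict d {1..n}) (snd (d (n + 1))) \<longleftrightarrow> 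
      exceeds (n + 1) (fc_score d) (fc_score d (n + 1) - \<delta>) (1 - \<alpha>)"
    if "d \<in> space (V (n + 1))" for d
    using fst_mem_Y[OF in_space_V[OF that, of "n + 1"]] omit_last[of d]
    unfolding PS_fc_def exceeds_def
    by (simp add: not_le_quantile_iff[unfolded not_le] not_le F_fc_eq_ecdf[OF that, simplified] fc_score_def[of _ "n + 1"])
  then have "{d \<in> space (K \<omega>). fst (d (n + 1)) \<notin> PS_fc Y c n \<alpha> \<delta> (restrict d {1..n}) (snd (d (n + 1)))}
      = miss_fc \<delta> \<alpha>"
    unfolding miss_fc_def K(3)[OF assms] by blast
  then show ?thesis
    unfolding noncoverage_def by simp
qed

lemma noncoverage_sc:
  assumes "\<omega> \<in> space M"
  shows "noncoverage (K \<omega>) n (PS_sc Y c n \<alpha> \<delta>) = measure (K \<omega>) (miss_sc \<delta> \<alpha>)"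
proof -
  have G: "G_sc c n (restrict d {1..n}) = ecdf n (sc_score d)" for d
  proof
    fix x
    have "(\<Sum>i=1..n. of_bool (c (n - 1) (restrict d {1..n} i) (omit n i (restrict d {1..n})) \<le> x) :: real)
        = (\<Sum>i=1..n. of_bool (sc_score d i \<le> x))"
      by (intro sum.cong) (auto simp: sc_score_def)
    then show "G_sc c n (restrict d {1..n}) x = ecdf n (sc_score d) x"
      unfolding G_sc_def sum_of_bool_le_eq_ecdf[symmetric] by simp
  qed
  have "fst (d (n + 1)) \<notin> PS_sc Y c n \<alpha> \<delta> (restrict d {1..n}) (snd (d (n + 1))) \<longleftrightarrow> 
      exceeds n (sc_score d) (fc_score d (n + 1) - \<delta>) (1 - \<alpha>)"
    if "d \<in> space (V (n + 1))" for d
    using fst_mem_Y[OF in_space_V[OF that, of "n + 1"]] omit_last[of d]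
    unfolding PS_sc_def exceeds_def
    by (simp add: not_le_quantile_iff[unfolded not_le] not_le G fc_score_def[of _ "n + 1"])
  then have "{d \<in> space (K \<omega>). fst (d (n + 1)) \<notin> PS_sc Y c n \<alpha> \<delta> (restrict d {1..n}) (snd (d (n + 1)))}
      = miss_sc \<delta> \<alpha>"
    unfolding miss_sc_def K(3)[OF assms] by blast
  then show ?thesis
    unfolding noncoverage_def by simp
qed

lemma miss_fc_locally_constant: "\<exists>\<eta>>0. \<forall>\<beta>. \<alpha> \<le> \<beta> \<longrightarrow> \<beta> < \<alpha> + \<eta> \<longrightarrow> miss_fc \<delta> \<beta> = miss_fc \<delta> \<alpha>"
proof -
  obtain \<eta> where \<eta>: "\<eta> > 0" "\<forall>v. 1 - \<alpha> - \<eta> < v \<longrightarrow> v \<le> 1 - \<alpha> \<longrightarrow>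
      (\<forall>a s. exceeds (n + 1) a s v = exceeds (n + 1) a s (1 - \<alpha>))"
    using exceeds_locally_constant by blast
  have "miss_fc \<delta> \<beta> = miss_fc \<delta> \<alpha>" if "\<alpha> \<le> \<beta>" "\<beta> < \<alpha> + \<eta>" for \<beta>
    using \<eta>(2)[rule_format, of "1 - \<beta>"] that unfolding miss_fc_def by auto
  then show ?thesis using \<eta>(1) by blast
qed

lemma miss_sc_locally_constant: "\<exists>\<eta>>0. \<forall>\<beta>. \<alpha> \<le> \<beta> \<longrightarrow> \<beta> < \<alpha> + \<eta> \<longrightarrow> miss_sc \<delta> \<beta> = miss_sc \<delta> \<alpha>"
proof -
  obtain \<eta> where \<eta>: "\<eta> > 0" "\<forall>v. 1 - \<alpha> - \<eta> < v \<longrightarrow> v \<le> 1 - \<alpha> \<longrightarrow>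
      (\<forall>a s. exceeds n a s v = exceeds n a s (1 - \<alpha>))"
    using exceeds_locally_constant by blast
  have "miss_sc \<delta> \<beta> = miss_sc \<delta> \<alpha>" if "\<alpha> \<le> \<beta>" "\<beta> < \<alpha> + \<eta>" for \<beta>
    using \<eta>(2)[rule_format, of "1 - \<beta>"] that unfolding miss_sc_def by auto
  then show ?thesis using \<eta>(1) by blast
qed

text \<open>Suprema over all levels are random variables because the events depend on the level in a way that
  is locally constant to the right.\<close>

lemma measurable_SUP:
  fixes g :: "real \<Rightarrow> real \<Rightarrow> real"
  assumes sets: "\<And>\<alpha>. E \<alpha> \<in> sets (V (n + 1))"
    and const: "\<And>\<alpha>. \<exists>\<eta>>0. \<forall>\<beta>. \<alpha> \<le> \<beta> \<longrightarrow> \<beta> < \<alpha> + \<eta> \<longrightarrow> E \<beta> = E \<alpha>"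
    and g: "\<And>x. continuous_on UNIV (g x)" "\<And>\<alpha>. (\<lambda>x. g x \<alpha>) \<in> borel_measurable borel"
    and bdd: "\<And>x \<alpha>. 0 \<le> x \<Longrightarrow> x \<le> 1 \<Longrightarrow> \<alpha> \<in> {0..1} \<Longrightarrow> g x \<alpha> \<le> B"
  shows "(\<lambda>\<omega>. SUP \<alpha>\<in>{0..1}. g (measure (K \<omega>) (E \<alpha>)) \<alpha>) \<in> borel_measurable M"
proof -
  have le: "g (measure (K \<omega>) (E \<alpha>)) \<alpha> \<le> B" if "\<omega> \<in> space M" "\<alpha> \<in> {0..1}" for \<omega> \<alpha>
    using that by (intro bdd K_measure_le_1) auto
  have "(SUP \<alpha>\<in>{0..1}. g (measure (K \<omega>) (E \<alpha>)) \<alpha>) = (SUP \<alpha>\<in>{0..1} \<inter> \<rat>. g (measure (K \<omega>) (E \<alpha>)) \<alpha>)"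
    if "\<omega> \<in> space M" for \<omega>
  proof (rule SUP_unit_interval_eq_SUP_rats)
    fix \<alpha> :: real
    obtain \<eta> where \<eta>: "\<eta> > 0" "\<forall>\<beta>. \<alpha> \<le> \<beta> \<longrightarrow> \<beta> < \<alpha> + \<eta> \<longrightarrow> E \<beta> = E \<alpha>"
      using const[of \<alpha>] by (elim exE conjE) (rule that)
    have "\<forall>\<^sub>F \<beta> in at_right \<alpha>. g (measure (K \<omega>) (E \<alpha>)) \<beta> = g (measure (K \<omega>) (E \<beta>)) \<beta>"
      unfolding eventually_at_right_field
    proof (intro exI[of _ "\<alpha> + \<eta>"] conjI allI impI)
      fix \<beta> assume "\<alpha> < \<beta>" "\<beta> < \<alpha> + \<eta>"
      then have "E \<beta> = E \<alpha>"
        using \<eta>(2) less_imp_le by blast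
      then show "g (measure (K \<omega>) (E \<alpha>)) \<beta> = g (measure (K \<omega>) (E \<beta>)) \<beta>"
        by (rule arg_cong[where f = "\<lambda>S. g (measure (K \<omega>) S) \<beta>", OF sym])
    qed (use \<eta>(1) in simp)
    moreover have "(g (measure (K \<omega>) (E \<alpha>)) \<longlongrightarrow> g (measure (K \<omega>) (E \<alpha>)) \<alpha>) (at_right \<alpha>)"
      using g(1)[of "measure (K \<omega>) (E \<alpha>)"]
      by (meson UNIV_I continuous_on_def tendsto_within_subset subset_UNIV)
    ultimately show "((\<lambda>\<alpha>. g (measure (K \<omega>) (E \<alpha>)) \<alpha>) \<longlongrightarrow> g (measure (K \<omega>) (E \<alpha>)) \<alpha>) (at_right \<alpha>)"
      by (rule Lim_transform_eventually[rotated])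
  qed (rule le[OF that])
  moreover have "(\<lambda>\<omega>. SUP \<alpha>\<in>{0..1} \<inter> \<rat>. g (measure (K \<omega>) (E \<alpha>)) \<alpha>) \<in> borel_measurable M"
  proof (rule borel_measurable_cSUP)
    show "countable ({0..1} \<inter> \<rat> :: real set)"
      using countable_rat by blast
    show "(\<lambda>\<omega>. g (measure (K \<omega>) (E \<alpha>)) \<alpha>) \<in> borel_measurable M" for \<alpha>
      by (rule measurable_compose[OF measurable_K_measure[OF sets] g(2)])
    show "bdd_above ((\<lambda>\<alpha>. g (measure (K \<omega>) (E \<alpha>)) \<alpha>) ` ({0..1} \<inter> \<rat>))" if "\<omega> \<in> space M" for \<omega>
      using le[OF that] by (intro bdd_aboveI[of _ B]) auto
  qed
  ultimately show ?thesis
    by (subst measurable_cong) auto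
qed

section \<open>The exceptional event\<close>

lemma distr_sample: "distr M (V (n + 1)) (sample t (n + 1)) = PiM {1..n + 1} (\<lambda>_. P)"
proof -
  have "distr M (V (n + 1)) (sample t (n + 1)) = (\<Pi>\<^sub>M i\<in>{1..n + 1}. distr M Z (t i))"
    using indep measurable_t unfolding vectors_def sample_def
    by (subst (asm) indep_vars_iff_distr_eq_PiM') auto
  also have "\<dots> = PiM {1..n + 1} (\<lambda>_. P)"
    by (intro PiM_cong) (simp_all only: distr_t)
  finally show ?thesis .
qed

text \<open>Stability concerns the test point only. Moving the \<open>i\<close>-th observation to the test position and closing
  the gap leaves the joint law of the sample unchanged and lists the remaining points in the order in
  which \<open>omit\<close> leaves them, so it turns the deviation of the \<open>i\<close>-th scores into the one in the
  definition of stability.\<close>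

lemma prob_deviation:
  assumes i: "i \<in> {1..n}"
  shows "measure M {\<omega> \<in> space M. \<epsilon> \<le> \<bar>fc_score (sample t (n + 1) \<omega>) i - sc_score (sample t (n + 1) \<omega>) i\<bar>} =
    measure M {\<omega> \<in> space M. \<epsilon> \<le> \<bar>c n (t (n + 1) \<omega>) (sample t n \<omega>) -
         c (n - 1) (t (n + 1) \<omega>) (omit n n (sample t n \<omega>))\<bar>}"
proof -
  define Q where "Q = PiM {1..n + 1} (\<lambda>_::nat. P)"
  define \<sigma> where "\<sigma> j = (if j = n + 1 then i else if j < i then j else Suc j)" for j
  define \<rho> where "\<rho> = (\<lambda>d. \<lambda>j\<in>{1..n + 1}. (d (\<sigma> j)) :: point)"
  define A where "A = {d \<in> space (V (n + 1)). \<epsilon> \<le> \<bar>fc_score d i - sc_score d i\<bar>}"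
  define A' where "A' = {d \<in> space (V (n + 1)). 
    \<epsilon> \<le> \<bar>c n (d (n + 1)) (restrict d {1..n}) - c (n - 1) (d (n + 1)) (omit n n (restrict d {1..n}))\<bar>}"
  have sets_Q: "sets Q = sets (V (n + 1))"
    unfolding Q_def vectors_def by (intro sets_PiM_cong) (auto simp: sets_P)
  note space_Q = sets_eq_imp_space_eq[OF sets_Q]
  have "inj_on \<sigma> {1..n + 1}" "\<sigma> \<in> {1..n + 1} \<rightarrow> {1..n + 1}"
    using i by (auto simp: \<sigma>_def inj_on_def split: if_splits)
  then have \<rho>: "distr Q Q \<rho> = Q"
    unfolding Q_def \<rho>_def by (intro distr_PiM_reindex P)
  have [measurable]: "(\<lambda>d. fc_score d i) \<in> borel_measurable (V (n + 1))"
      "(\<lambda>d. sc_score d i) \<in> borel_measurable (V (n + 1))"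
    using i by (auto intro: measurable_fc_score measurable_sc_score)
  have A: "A \<in> sets (V (n + 1))"
    unfolding A_def by measurable
  have "(\<lambda>d. c n (d (n + 1)) (restrict d {1..n})) \<in> borel_measurable (V (n + 1))"
    using n by (intro measurable_score measurable_component measurable_restrict_vectors) auto
  moreover have "(\<lambda>d. c (n - 1) (d (n + 1)) (omit n n (restrict d {1..n}))) \<in> borel_measurable (V (n + 1))"
  proof (intro measurable_score measurable_component)
    have "omit (n - 1 + 1) n \<in> V (n - 1 + 1) \<rightarrow>\<^sub>M V (n - 1)"
      by (rule measurable_omit)
    then have "omit n n \<in> V n \<rightarrow>\<^sub>M V (n - 1)"
      using n by simp
    then show "(\<lambda>d. omit n n (restrict d {1..n})) \<in> V (n + 1) \<rightarrow>\<^sub>M V (n - 1)"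
      by (rule measurable_compose[rotated]) (rule measurable_restrict_vectors, simp)
  qed (use n in auto)
  ultimately have A': "A' \<in> sets (V (n + 1))"
    unfolding A'_def by measurable
  have m\<rho>: "\<rho> \<in> Q \<rightarrow>\<^sub>M Q"
    unfolding \<rho>_def Q_def using \<open>\<sigma> \<in> {1..n + 1} \<rightarrow> {1..n + 1}\<close>
    by (intro measurable_restrict measurable_component_singleton) auto
  have "\<rho> d (n + 1) = d i" and "restrict (\<rho> d) {1..n} = omit (n + 1) i d"
    and "omit n n (restrict (\<rho> d) {1..n}) = omit n i (restrict d {1..n})" for d
  proof -
    show "\<rho> d (n + 1) = d i" by (simp add: \<rho>_def \<sigma>_def)
    show "restrict (\<rho> d) {1..n} = omit (n + 1) i d"
      unfolding omit_def by (auto simp: \<rho>_def \<sigma>_def restrict_def)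
    show "omit n n (restrict (\<rho> d) {1..n}) = omit n i (restrict d {1..n})"
      unfolding omit_def using i n by (intro restrict_ext) (auto simp: \<rho>_def \<sigma>_def)
  qed
  then have \<rho>_A': "\<rho> -` A' \<inter> space Q = A"
    using measurable_space[OF m\<rho>] unfolding A_def A'_def fc_score_def sc_score_def space_Q
    by auto
  have law: "measure Q B = measure M {\<omega> \<in> space M. sample t (n + 1) \<omega> \<in> B}" if "B \<in> sets (V (n + 1))" for B
    using that measurable_sample[of "n + 1"] unfolding Q_def distr_sample[symmetric]
    by (subst measure_distr) (auto intro!: arg_cong[where f = "measure M"])
  have sp: "\<omega> \<in> space M \<Longrightarrow> sample t (n + 1) \<omega> \<in> space (V (n + 1))" for \<omega>
    using measurable_space[OF measurable_sample[of "n + 1"]] by simp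
  have "restrict (sample t (n + 1) \<omega>) {1..n} = sample t n \<omega>" for \<omega>
    by (auto simp: sample_def restrict_def)
  moreover have "sample t (n + 1) \<omega> (n + 1) = t (n + 1) \<omega>" for \<omega>
    by (simp add: sample_def)
  ultimately have "measure Q A' = measure M {\<omega> \<in> space M. \<epsilon> \<le> \<bar>c n (t (n + 1) \<omega>) (sample t n \<omega>) -
         c (n - 1) (t (n + 1) \<omega>) (omit n n (sample t n \<omega>))\<bar>}"
    unfolding law[OF A'] using sp by (auto simp: A'_def intro!: arg_cong[where f = "measure M"])
  moreover have "measure Q A = measure M {\<omega> \<in> space M. \<epsilon> \<le> \<bar>fc_score (sample t (n + 1) \<omega>) i - sc_score (sample t (n + 1) \<omega>) i\<bar>}"
    unfolding law[OF A] using sp by (auto simp: A_def intro!: arg_cong[where f = "measure M"])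
  moreover have "measure Q A' = measure (distr Q Q \<rho>) A'"
    by (simp add: \<rho>)
  then have "measure Q A' = measure Q A"
    using \<rho>_A' A' m\<rho> by (simp add: measure_distr sets_Q)
  ultimately show ?thesis by simp
qed

lemma integral_K_measure:
  assumes "B \<in> sets (V (n + 1))"
  shows "(\<integral>\<omega>. measure (K \<omega>) B \<partial>M) = measure M (sample t (n + 1) -` B \<inter> space M)"
proof -
  have A: "sample t (n + 1) -` B \<inter> space M \<in> sets M"
    using measurable_sample[of "n + 1"] assms by (auto intro: measurable_sets)
  have "AE \<omega> in M. measure (K \<omega>) B = real_cond_exp M F (indicator (sample t (n + 1) -` B \<inter> space M)) \<omega>"
    using cond assms unfolding regular_cond_distr_def by blast
  then have "(\<integral>\<omega>. measure (K \<omega>) B \<partial>M) =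
      (\<integral>\<omega>. real_cond_exp M F (indicator (sample t (n + 1) -` B \<inter> space M)) \<omega> \<partial>M)"
    using assms by (intro integral_cong_AE) auto
  also have "\<dots> = (\<integral>\<omega>. indicator (sample t (n + 1) -` B \<inter> space M) \<omega> \<partial>M)"
    using A by (intro F.real_cond_exp_int(2)) (auto simp: emeasure_eq_measure)
  also have "\<dots> = measure M (sample t (n + 1) -` B \<inter> space M)"
    using A by simp
  finally show ?thesis .
qed

text \<open>By Markov's inequality, the exceptional event has small probability, and hence small conditional
  probability on average.\<close>

lemma integral_K_bad_le:
  assumes \<eta>: "\<eta> > 0"
  shows "(\<integral>\<omega>. measure (K \<omega>) (bad \<epsilon> \<eta>) \<partial>M) \<le>
    measure M {\<omega> \<in> space M. \<bar>c n (t (n + 1) \<omega>) (sample t n \<omega>) -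
         c (n - 1) (t (n + 1) \<omega>) (omit n n (sample t n \<omega>))\<bar> \<ge> \<epsilon>} / \<eta>" (is "_ \<le> ?\<beta> / \<eta>")
proof -
  let ?S = "sample t (n + 1)"
  define D where "D i = {\<omega> \<in> space M. \<epsilon> \<le> \<bar>fc_score (?S \<omega>) i - sc_score (?S \<omega>) i\<bar>}" for i
  define u where "u \<omega> = (\<Sum>i=1..n. indicator (D i) \<omega> :: real)" for \<omega>
  have D: "D i \<in> events" if "i \<in> {1..n}" for i
  proof -
    have [measurable]: "(\<lambda>\<omega>. fc_score (?S \<omega>) i) \<in> borel_measurable M" "(\<lambda>\<omega>. sc_score (?S \<omega>) i) \<in> borel_measurable M"
      using that by (auto intro!: measurable_compose[OF measurable_sample] measurable_fc_score measurable_sc_score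
          simp del: add_Suc_right)
    show ?thesis unfolding D_def by measurable
  qed
  have u: "u \<omega> = card {i \<in> {1..n}. \<epsilon> \<le> \<bar>fc_score (?S \<omega>) i - sc_score (?S \<omega>) i\<bar>}" if "\<omega> \<in> space M" for \<omega>
    using that unfolding u_def D_def indicator_def by (simp add: Int_def)
  have sp: "\<omega> \<in> space M \<Longrightarrow> ?S \<omega> \<in> space (V (n + 1))" for \<omega>
    using measurable_space[OF measurable_sample[of "n + 1"]] by simp
  have int: "integrable M u"
    unfolding u_def using D by (intro Bochner_Integration.integrable_sum) (auto simp: emeasure_eq_measure)
  have "(\<integral>\<omega>. measure (K \<omega>) (bad \<epsilon> \<eta>) \<partial>M) = measure M (?S -` bad \<epsilon> \<eta> \<inter> space M)"
    by (rule integral_K_measure[OF sets_bad])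
  also have "\<dots> \<le> measure M {\<omega> \<in> space M. u \<omega> \<ge> n * \<eta>}"
    using int by (intro finite_measure_mono) (auto simp: bad_def u)
  also have "\<dots> \<le> (\<integral>\<omega>. u \<omega> \<partial>M) / (n * \<eta>)"
    using n \<eta> by (intro integral_Markov_inequality_measure[OF int sets.empty_sets]) (auto simp: u_def sum_nonneg)
  also have "(\<integral>\<omega>. u \<omega> \<partial>M) = (\<Sum>i=1..n. measure M (D i))"
    unfolding u_def using D by (subst Bochner_Integration.integral_sum) (auto simp: emeasure_eq_measure)
  also have "\<dots> = (\<Sum>i=1..n. ?\<beta>)"
    unfolding D_def by (intro sum.cong prob_deviation) auto
  also have "\<dots> / (n * \<eta>) = ?\<beta> / \<eta>"
    using n by simp
  finally show ?thesis .
qed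

text \<open>Off the exceptional event, the two prediction sets are nested up to a shift of the threshold by \<open>\<epsilon>\<close>
  and of the level by \<open>\<eta> + 1/n\<close>.\<close>

lemma miss_compare:
  shows "miss_fc \<delta> \<alpha> \<subseteq> miss_sc (\<delta> - \<epsilon>) (\<alpha> + (\<eta> + 1 / n)) \<union> bad \<epsilon> \<eta>"
    and "miss_sc \<delta> \<alpha> \<subseteq> miss_fc (\<delta> - \<epsilon>) (\<alpha> + (\<eta> + 1 / n)) \<union> bad \<epsilon> \<eta>"
proof -
  have n1: "n \<ge> 1" using n by simp
  show "miss_fc \<delta> \<alpha> \<subseteq> miss_sc (\<delta> - \<epsilon>) (\<alpha> + (\<eta> + 1 / n)) \<union> bad \<epsilon> \<eta>"
  proof
    fix d assume d: "d \<in> miss_fc \<delta> \<alpha>"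
    show "d \<in> miss_sc (\<delta> - \<epsilon>) (\<alpha> + (\<eta> + 1 / n)) \<union> bad \<epsilon> \<eta>"
    proof (cases "d \<in> bad \<epsilon> \<eta>")
      case False
      have sp: "d \<in> space (V (n + 1))"
        and ex: "exceeds (n + 1) (fc_score d) (fc_score d (n + 1) - \<delta>) (1 - \<alpha>)"
        using d unfolding miss_fc_def by blast+
      have "real (card {i \<in> {1..n}. \<epsilon> \<le> \<bar>fc_score d i - sc_score d i\<bar>}) \<le> real n * \<eta>"
        using False sp unfolding bad_def by (simp add: not_less)
      from exceeds_compare(2)[OF n1 this ex] show ?thesis
        using sp unfolding miss_sc_def diff_diff_eq diff_diff_eq2 by (simp add: algebra_simps)
    qed simp
  qed
  show "miss_sc \<delta> \<alpha> \<subseteq> miss_fc (\<delta> - \<epsilon>) (\<alpha> + (\<eta> + 1 / n)) \<union> bad \<epsilon> \<eta>"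
  proof
    fix d assume d: "d \<in> miss_sc \<delta> \<alpha>"
    show "d \<in> miss_fc (\<delta> - \<epsilon>) (\<alpha> + (\<eta> + 1 / n)) \<union> bad \<epsilon> \<eta>"
    proof (cases "d \<in> bad \<epsilon> \<eta>")
      case False
      have sp: "d \<in> space (V (n + 1))"
        and ex: "exceeds n (sc_score d) (fc_score d (n + 1) - \<delta>) (1 - \<alpha>)"
        using d unfolding miss_sc_def by blast+
      have "real (card {i \<in> {1..n}. \<epsilon> \<le> \<bar>fc_score d i - sc_score d i\<bar>}) \<le> real n * \<eta>"
        using False sp unfolding bad_def by (simp add: not_less)
      from exceeds_compare(1)[OF n1 this ex] show ?thesis
        using sp unfolding miss_fc_def diff_diff_eq diff_diff_eq2 by (simp add: algebra_simps)
    qed simp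
  qed
qed

section \<open>Comparison in probability\<close>

text \<open>The largest excess of the conditional noncoverage probability over the nominal level, for either
  kind of prediction set.\<close>

definition excess_fc :: "real \<Rightarrow> 'w \<Rightarrow> real" where
  "excess_fc \<delta> \<omega> = (SUP \<alpha>\<in>{0..1}. noncoverage (K \<omega>) n (PS_fc Y c n \<alpha> \<delta>) - \<alpha>)"

definition excess_sc :: "real \<Rightarrow> 'w \<Rightarrow> real" where
  "excess_sc \<delta> \<omega> = (SUP \<alpha>\<in>{0..1}. noncoverage (K \<omega>) n (PS_sc Y c n \<alpha> \<delta>) - \<alpha>)"

text \<open>The largest absolute difference between conditional noncoverage probability and nominal level,
  without inflation of the prediction sets.\<close>

definition error_fc :: "'w \<Rightarrow> real" where
  "error_fc \<omega> = (SUP \<alpha>\<in>{0..1}. \<bar>noncoverage (K \<omega>) n (PS_fc Y c n \<alpha> 0) - \<alpha>\<bar>)"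

definition error_sc :: "'w \<Rightarrow> real" where
  "error_sc \<omega> = (SUP \<alpha>\<in>{0..1}. \<bar>noncoverage (K \<omega>) n (PS_sc Y c n \<alpha> 0) - \<alpha>\<bar>)"

text \<open>The probability that, by the notion of stability, has to tend to zero for every fixed \<open>\<epsilon> > 0\<close>.\<close>

definition instability :: "real \<Rightarrow> real" where
  "instability \<epsilon> = measure M {\<omega> \<in> space M. \<bar>c n (t (n + 1) \<omega>) (sample t n \<omega>) -
         c (n - 1) (t (n + 1) \<omega>) (omit n n (sample t n \<omega>))\<bar> \<ge> \<epsilon>}"

lemma measurable_excess:
  "excess_fc \<delta> \<in> borel_measurable M" "excess_sc \<delta> \<in> borel_measurable M"
proof -
  have "(\<lambda>\<omega>. SUP \<alpha>\<in>{0..1}. measure (K \<omega>) (miss_fc \<delta> \<alpha>) - \<alpha>) \<in> borel_measurable M"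
    by (rule measurable_SUP[OF sets_miss_fc miss_fc_locally_constant, where B = 1])
      (auto intro!: continuous_intros)
  then show "excess_fc \<delta> \<in> borel_measurable M"
    by (rule measurable_cong[THEN iffD1, rotated]) (simp add: excess_fc_def noncoverage_fc)
  have "(\<lambda>\<omega>. SUP \<alpha>\<in>{0..1}. measure (K \<omega>) (miss_sc \<delta> \<alpha>) - \<alpha>) \<in> borel_measurable M"
    by (rule measurable_SUP[OF sets_miss_sc miss_sc_locally_constant, where B = 1])
      (auto intro!: continuous_intros)
  then show "excess_sc \<delta> \<in> borel_measurable M"
    by (rule measurable_cong[THEN iffD1, rotated]) (simp add: excess_sc_def noncoverage_sc)
qed

lemma measurable_error:
  "error_fc \<in> borel_measurable M" "error_sc \<in> borel_measurable M"
proof -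
  have "(\<lambda>\<omega>. SUP \<alpha>\<in>{0..1}. \<bar>measure (K \<omega>) (miss_fc 0 \<alpha>) - \<alpha>\<bar>) \<in> borel_measurable M"
    by (rule measurable_SUP[OF sets_miss_fc miss_fc_locally_constant, where B = 1])
      (auto intro!: continuous_intros)
  then show "error_fc \<in> borel_measurable M"
    by (rule measurable_cong[THEN iffD1, rotated]) (simp add: error_fc_def noncoverage_fc)
  have "(\<lambda>\<omega>. SUP \<alpha>\<in>{0..1}. \<bar>measure (K \<omega>) (miss_sc 0 \<alpha>) - \<alpha>\<bar>) \<in> borel_measurable M"
    by (rule measurable_SUP[OF sets_miss_sc miss_sc_locally_constant, where B = 1])
      (auto intro!: continuous_intros)
  then show "error_sc \<in> borel_measurable M"
    by (rule measurable_cong[THEN iffD1, rotated]) (simp add: error_sc_def noncoverage_sc)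
qed

lemma error_bounds:
  assumes "\<omega> \<in> space M"
  shows "error_fc \<omega> \<in> {0..1}" "error_sc \<omega> \<in> {0..1}"
  unfolding error_fc_def error_sc_def noncoverage_fc[OF assms] noncoverage_sc[OF assms]
  using K_measure_le_1[OF assms] by (intro SUP_abs_unit measure_nonneg; simp)+

lemma miss_measure_compare:
  assumes "\<omega> \<in> space M"
  shows "measure (K \<omega>) (miss_fc \<delta> \<alpha>) \<le>
      measure (K \<omega>) (miss_sc (\<delta> - \<epsilon>) (\<alpha> + (\<eta> + 1 / n))) + measure (K \<omega>) (bad \<epsilon> \<eta>)"
    and "measure (K \<omega>) (miss_sc \<delta> \<alpha>) \<le>
      measure (K \<omega>) (miss_fc (\<delta> - \<epsilon>) (\<alpha> + (\<eta> + 1 / n))) + measure (K \<omega>) (bad \<epsilon> \<eta>)"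
proof -
  interpret K: prob_space "K \<omega>"
    by (rule K(1)[OF assms])
  note s = sets_miss_fc sets_miss_sc sets_bad K(2)[OF assms]
  have "measure (K \<omega>) (miss_fc \<delta> \<alpha>) \<le>
      measure (K \<omega>) (miss_sc (\<delta> - \<epsilon>) (\<alpha> + (\<eta> + 1 / n)) \<union> bad \<epsilon> \<eta>)"
    by (intro K.finite_measure_mono miss_compare) (simp add: s sets.Un)
  also have "\<dots> \<le> measure (K \<omega>) (miss_sc (\<delta> - \<epsilon>) (\<alpha> + (\<eta> + 1 / n))) + measure (K \<omega>) (bad \<epsilon> \<eta>)"
    by (intro measure_Un_le) (simp_all add: s)
  finally show "measure (K \<omega>) (miss_fc \<delta> \<alpha>) \<le>
      measure (K \<omega>) (miss_sc (\<delta> - \<epsilon>) (\<alpha> + (\<eta> + 1 / n))) + measure (K \<omega>) (bad \<epsilon> \<eta>)" .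
  have "measure (K \<omega>) (miss_sc \<delta> \<alpha>) \<le>
      measure (K \<omega>) (miss_fc (\<delta> - \<epsilon>) (\<alpha> + (\<eta> + 1 / n)) \<union> bad \<epsilon> \<eta>)"
    by (intro K.finite_measure_mono miss_compare) (simp add: s sets.Un)
  also have "\<dots> \<le> measure (K \<omega>) (miss_fc (\<delta> - \<epsilon>) (\<alpha> + (\<eta> + 1 / n))) + measure (K \<omega>) (bad \<epsilon> \<eta>)"
    by (intro measure_Un_le) (simp_all add: s)
  finally show "measure (K \<omega>) (miss_sc \<delta> \<alpha>) \<le>
      measure (K \<omega>) (miss_fc (\<delta> - \<epsilon>) (\<alpha> + (\<eta> + 1 / n))) + measure (K \<omega>) (bad \<epsilon> \<eta>)" .
qed

lemma excess_compare:
  assumes \<omega>: "\<omega> \<in> space M" and \<eta>: "\<eta> > 0"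
  shows "excess_fc \<delta> \<omega> \<le> excess_sc (\<delta> - \<epsilon>) \<omega> + (\<eta> + 1 / n) + measure (K \<omega>) (bad \<epsilon> \<eta>)"
    and "excess_sc \<delta> \<omega> \<le> excess_fc (\<delta> - \<epsilon>) \<omega> + (\<eta> + 1 / n) + measure (K \<omega>) (bad \<epsilon> \<eta>)"
proof -
  have one: "measure (K \<omega>) (miss_fc \<delta> 1) = 1" "measure (K \<omega>) (miss_sc \<delta> 1) = 1" for \<delta>
    using prob_space.prob_space[OF K(1)[OF \<omega>]] unfolding miss_fc_def miss_sc_def K(3)[OF \<omega>]
    by (simp_all add: exceeds_nonpos)
  show "excess_fc \<delta> \<omega> \<le> excess_sc (\<delta> - \<epsilon>) \<omega> + (\<eta> + 1 / n) + measure (K \<omega>) (bad \<epsilon> \<eta>)"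
    unfolding excess_fc_def excess_sc_def noncoverage_fc[OF \<omega>] noncoverage_sc[OF \<omega>]
    by (intro SUP_excess_le K_measure_le_1 \<omega> one miss_measure_compare) (use \<eta> in auto)
  show "excess_sc \<delta> \<omega> \<le> excess_fc (\<delta> - \<epsilon>) \<omega> + (\<eta> + 1 / n) + measure (K \<omega>) (bad \<epsilon> \<eta>)"
    unfolding excess_fc_def excess_sc_def noncoverage_fc[OF \<omega>] noncoverage_sc[OF \<omega>]
    by (intro SUP_excess_le K_measure_le_1 \<omega> one miss_measure_compare) (use \<eta> in auto)
qed

lemma integrable_K_measure: "B \<in> sets (V (n + 1)) \<Longrightarrow> integrable M (\<lambda>\<omega>. measure (K \<omega>) B)"
  by (rule integrable_const_bound[of _ 1]) (auto intro!: measurable_K_measure K_measure_le_1)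

text \<open>If \<open>X\<close> is at least \<open>e\<close>, then \<open>W\<close> or the conditional probability of the exceptional event is at least
  \<open>e / 3\<close>; the latter is controlled by Markov's inequality.\<close>

lemma tail_prob_le:
  assumes X: "X \<in> borel_measurable M" and W: "W \<in> borel_measurable M" and e: "e > 0" and \<eta>: "\<eta> > 0"
    and small: "\<eta> + 1 / n \<le> e / 3"
    and le: "\<And>\<omega>. \<omega> \<in> space M \<Longrightarrow> X \<omega> \<le> W \<omega> + (\<eta> + 1 / n) + measure (K \<omega>) (bad \<epsilon> \<eta>)"
  shows "measure M {\<omega> \<in> space M. X \<omega> \<ge> e} \<le>
    measure M {\<omega> \<in> space M. W \<omega> \<ge> e / 3} + instability \<epsilon> / \<eta> / (e / 3)"
proof -
  note [measurable] = X W measurable_K_measure[OF sets_bad]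
  have "{\<omega> \<in> space M. X \<omega> \<ge> e} \<subseteq>
      {\<omega> \<in> space M. W \<omega> \<ge> e / 3} \<union> {\<omega> \<in> space M. measure (K \<omega>) (bad \<epsilon> \<eta>) \<ge> e / 3}"
    using le small by fastforce
  then have "measure M {\<omega> \<in> space M. X \<omega> \<ge> e} \<le>
      measure M ({\<omega> \<in> space M. W \<omega> \<ge> e / 3} \<union> {\<omega> \<in> space M. measure (K \<omega>) (bad \<epsilon> \<eta>) \<ge> e / 3})"
    by (rule finite_measure_mono) measurable
  also have "\<dots> \<le> measure M {\<omega> \<in> space M. W \<omega> \<ge> e / 3} +
      measure M {\<omega> \<in> space M. measure (K \<omega>) (bad \<epsilon> \<eta>) \<ge> e / 3}"
    by (rule measure_Un_le) measurable
  also have "measure M {\<omega> \<in> space M. measure (K \<omega>) (bad \<epsilon> \<eta>) \<ge> e / 3} \<le>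
      (\<integral>\<omega>. measure (K \<omega>) (bad \<epsilon> \<eta>) \<partial>M) / (e / 3)"
    using e by (intro integral_Markov_inequality_measure[OF integrable_K_measure[OF sets_bad] sets.empty_sets]) auto
  also have "\<dots> \<le> instability \<epsilon> / \<eta> / (e / 3)"
    using integral_K_bad_le[OF \<eta>, of \<epsilon>] e unfolding instability_def by (intro divide_right_mono) auto
  finally show ?thesis by simp
qed

lemma excess_tail_compare:
  assumes "e > 0" "\<eta> > 0" "\<eta> + 1 / n \<le> e / 3"
  shows "measure M {\<omega> \<in> space M. excess_fc \<delta> \<omega> \<ge> e} \<le>
      measure M {\<omega> \<in> space M. excess_sc (\<delta> - \<epsilon>) \<omega> \<ge> e / 3} + instability \<epsilon> / \<eta> / (e / 3)"
    and "measure M {\<omega> \<in> space M. excess_sc \<delta> \<omega> \<ge> e} \<le>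
      measure M {\<omega> \<in> space M. excess_fc (\<delta> - \<epsilon>) \<omega> \<ge> e / 3} + instability \<epsilon> / \<eta> / (e / 3)"
  by (intro tail_prob_le measurable_excess assms excess_compare; assumption)+

section \<open>Comparison in expectation\<close>

text \<open>Conditionally on the training sample, a function of the training sample is almost surely constant.
  For real functions, it suffices to look at the countably many events \<open>h \<le> q\<close> with rational \<open>q\<close>.\<close>

lemma AE_K_training_part:
  assumes h: "h \<in> borel_measurable (V n)"
  shows "AE \<omega> in M. AE d in K \<omega>. (h (restrict d {1..n}) :: real) = h (sample t n \<omega>)"
proof -
  define B where "B q = {d \<in> space (V (n + 1)). h (restrict d {1..n}) \<le> q}" for q
  define A where "A q = {\<omega> \<in> space M. h (sample t n \<omega>) \<le> q}" for q
  have "(\<lambda>d. h (restrict d {1..n})) \<in> borel_measurable (V (n + 1))"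
    by (rule measurable_compose[OF measurable_restrict_vectors h]) simp
  then have B: "B q \<in> sets (V (n + 1))" for q
    unfolding B_def by measurable
  have "sample t n \<in> F \<rightarrow>\<^sub>M V n"
    using measurable_sample[of n] by (intro measurable_vimage_algebra1) (auto dest: measurable_space)
  then have "(\<lambda>\<omega>. h (sample t n \<omega>)) \<in> borel_measurable F"
    using h by (rule measurable_compose)
  then have "{\<omega> \<in> space F. h (sample t n \<omega>) \<le> q} \<in> sets F" for q
    by measurable
  then have AF: "A q \<in> sets F" for q
    unfolding A_def by simp
  then have AM: "A q \<in> sets M" for q
    using subalgebra_F unfolding subalgebra_def by blast
  have restr: "restrict (sample t (n + 1) \<omega>) {1..n} = sample t n \<omega>" for \<omega>
    by (auto simp: sample_def restrict_def)
  have pre: "sample t (n + 1) -` B q \<inter> space M = A q" for q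
    using measurable_space[OF measurable_sample[of "n + 1"]] unfolding A_def B_def by (auto simp: restr)
  have K_B: "AE \<omega> in M. measure (K \<omega>) (B q) = real_cond_exp M F (indicator (A q)) \<omega>" for q
    using cond B[of q] unfolding regular_cond_distr_def pre[of q, symmetric] by blast
  have F_A: "AE \<omega> in M. real_cond_exp M F (indicator (A q)) \<omega> = indicator (A q) \<omega>" for q
    using AF AM by (intro F.real_cond_exp_F_meas) (auto simp: emeasure_eq_measure)
  have "AE \<omega> in M. measure (K \<omega>) (B q) = indicator (A q) \<omega>" for q
    using K_B[of q] F_A[of q] by eventually_elim simp
  then have "AE \<omega> in M. \<forall>q\<in>\<rat>. measure (K \<omega>) (B q) = indicator (A q) \<omega>"
    by (intro AE_ball_countable[THEN iffD2]) (auto intro: countable_rat)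
  then show ?thesis
  proof (rule AE_mp[OF _ AE_I2], intro impI)
    fix \<omega> assume \<omega>: "\<omega> \<in> space M" and eq: "\<forall>q\<in>\<rat>. measure (K \<omega>) (B q) = indicator (A q) \<omega>"
    interpret K: prob_space "K \<omega>"
      by (rule K(1)[OF \<omega>])
    have "AE d in K \<omega>. (h (restrict d {1..n}) \<le> q) = (h (sample t n \<omega>) \<le> q)" if q: "q \<in> \<rat>" for q
    proof (cases "h (sample t n \<omega>) \<le> q")
      case True
      then have "K.prob (B q) = 1" using eq q \<omega> by (simp add: A_def)
      then have "AE d in K \<omega>. d \<in> B q"
        using K.AE_in_set_eq_1 B[of q] K(2)[OF \<omega>] by blast
      then show ?thesis using True by (auto simp: B_def)
    next
      case False
      then have "K.prob (B q) = 0" using eq q \<omega> by (simp add: A_def)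
      then have "AE d in K \<omega>. d \<notin> B q"
        using B[of q] K(2)[OF \<omega>] by (intro AE_not_in) (auto simp: null_sets_def K.emeasure_eq_measure)
      then show ?thesis 
        by (rule AE_mp[OF _ AE_I2]) (use False K(3)[OF \<omega>] in \<open>auto simp: B_def\<close>)
    qed
    then have "AE d in K \<omega>. \<forall>q\<in>\<rat>. (h (restrict d {1..n}) \<le> q) = (h (sample t n \<omega>) \<le> q)"
      by (intro AE_ball_countable[THEN iffD2]) (auto intro: countable_rat)
    then show "AE d in K \<omega>. h (restrict d {1..n}) = h (sample t n \<omega>)"
      by (rule AE_mp[OF _ AE_I2]) (auto intro: real_eq_if_same_rat_upper)
  qed
qed

lemma AE_K_sc_score:
  "AE \<omega> in M. AE d in K \<omega>. \<forall>i\<in>{1..n}. sc_score d i = c (n - 1) (sample t n \<omega> i) (omit n i (sample t n \<omega>))"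
proof -
  have "AE \<omega> in M. \<forall>i\<in>{1..n}. AE d in K \<omega>. sc_score d i = c (n - 1) (sample t n \<omega> i) (omit n i (sample t n \<omega>))"
  proof (rule AE_finite_allI)
    fix i assume i: "i \<in> {1..n}"
    show "AE \<omega> in M. AE d in K \<omega>. sc_score d i = c (n - 1) (sample t n \<omega> i) (omit n i (sample t n \<omega>))"
      using AE_K_training_part[OF measurable_loo_score[OF i]] unfolding sc_score_restrict[OF i] .
  qed simp
  then show ?thesis
    by (rule AE_mp[OF _ AE_I2]) (auto intro: AE_finite_allI)
qed

text \<open>The only use of the density: given the training sample, the shortcut quantile is a constant, so a
  shift of the threshold by \<open>\<epsilon>\<close> changes the noncoverage probability by at most \<open>\<epsilon>\<close> times the bound
  on the density. There is no such direct statement for the full conformal quantile, which depends on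
  the test point.\<close>

lemma miss_sc_shift:
  assumes \<omega>: "\<omega> \<in> space M"
    and r: "AE d in K \<omega>. \<forall>i\<in>{1..n}. sc_score d i = r i"
    and dens: "distributed (K \<omega>) lborel (\<lambda>d. c n (d (n + 1)) (restrict d {1..n})) (\<lambda>x. ennreal (f x))"
    and f: "\<And>x. f x \<le> B" and B: "B \<ge> 0" and \<epsilon>: "\<epsilon> \<ge> 0"
  shows "measure (K \<omega>) (miss_sc (\<delta> - \<epsilon>) \<alpha>) \<le> measure (K \<omega>) (miss_sc \<delta> \<alpha>) + B * \<epsilon>"
proof -
  interpret K: prob_space "K \<omega>"
    by (rule K(1)[OF \<omega>])
  obtain q where q: "\<forall>s. exceeds n r (s + \<epsilon>) (1 - \<alpha>) \<longrightarrow> \<not> exceeds n r s (1 - \<alpha>) \<longrightarrow> s \<in> {q - \<epsilon>..q}"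
    using exceeds_diff_interval[OF \<epsilon>] by blast
  let ?s = "\<lambda>d. c n (d (n + 1)) (restrict d {1..n})"
  define I where "I = {q - \<epsilon> + \<delta>..q + \<delta>}"
  have s: "fc_score d (n + 1) = ?s d" for d
    by (simp add: fc_score_def omit_last)
  have sets_I: "?s -` I \<inter> space (K \<omega>) \<in> sets (K \<omega>)"
    using dens unfolding distributed_def I_def by (auto intro: measurable_sets)
  have "AE d in K \<omega>. d \<in> miss_sc (\<delta> - \<epsilon>) \<alpha> \<longrightarrow> d \<in> miss_sc \<delta> \<alpha> \<union> (?s -` I \<inter> space (K \<omega>))"
    using r
  proof (rule AE_mp[OF _ AE_I2], intro impI)
    fix d assume d: "d \<in> space (K \<omega>)" "\<forall>i\<in>{1..n}. sc_score d i = r i" "d \<in> miss_sc (\<delta> - \<epsilon>) \<alpha>"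
    have eq: "exceeds n (sc_score d) x u \<longleftrightarrow> exceeds n r x u" for x u
      using d(2) by (intro exceeds_cong) auto
    have "?s d - \<delta> \<in> {q - \<epsilon>..q}" if "d \<notin> miss_sc \<delta> \<alpha>"
    proof (rule q[rule_format])
      have "exceeds n r (?s d - (\<delta> - \<epsilon>)) (1 - \<alpha>)"
        using d(3) unfolding miss_sc_def mem_Collect_eq eq s by blast
      then show "exceeds n r (?s d - \<delta> + \<epsilon>) (1 - \<alpha>)"
        by (simp add: algebra_simps)
      show "\<not> exceeds n r (?s d - \<delta>) (1 - \<alpha>)"
        using that d(1) K(3)[OF \<omega>] unfolding miss_sc_def mem_Collect_eq eq s by blast
    qed
    then show "d \<in> miss_sc \<delta> \<alpha> \<union> (?s -` I \<inter> space (K \<omega>))"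
      using d(1) by (fastforce simp: I_def)
  qed
  then have "measure (K \<omega>) (miss_sc (\<delta> - \<epsilon>) \<alpha>) \<le> measure (K \<omega>) (miss_sc \<delta> \<alpha> \<union> (?s -` I \<inter> space (K \<omega>)))"
    using sets_I sets_miss_sc K(2)[OF \<omega>] by (intro K.finite_measure_mono_AE) auto
  also have "\<dots> \<le> measure (K \<omega>) (miss_sc \<delta> \<alpha>) + measure (K \<omega>) (?s -` I \<inter> space (K \<omega>))"
    using sets_I sets_miss_sc K(2)[OF \<omega>] by (intro measure_Un_le) auto
  also have "measure (K \<omega>) (?s -` I \<inter> space (K \<omega>)) \<le> B * \<epsilon>"
  proof -
    have "emeasure (K \<omega>) (?s -` I \<inter> space (K \<omega>)) = (\<integral>\<^sup>+x. ennreal (f x) * indicator I x \<partial>lborel)"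
      by (rule distributed_emeasure[OF dens]) (simp add: I_def)
    also have "\<dots> \<le> (\<integral>\<^sup>+x. ennreal B * indicator I x \<partial>lborel)"
      using f by (intro nn_integral_mono mult_right_mono ennreal_leI) auto
    also have "\<dots> = ennreal (B * \<epsilon>)"
      using \<epsilon> B by (simp add: nn_integral_cmult_indicator I_def ennreal_mult)
    finally show ?thesis
      using B \<epsilon> unfolding K.emeasure_eq_measure by (simp add: ennreal_le_iff)
  qed
  finally show ?thesis by simp
qed

text \<open>Both directions shift the threshold of the shortcut set only, before or after passing to the full
  conformal set.\<close>

lemma error_compare:
  assumes \<omega>: "\<omega> \<in> space M"
    and r: "AE d in K \<omega>. \<forall>i\<in>{1..n}. sc_score d i = r i"
    and dens: "distributed (K \<omega>) lborel (\<lambda>d. c n (d (n + 1)) (restrict d {1..n})) (\<lambda>x. ennreal (f x))"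
    and f: "\<And>x. f x \<le> B" and B: "B \<ge> 0" and \<epsilon>: "\<epsilon> \<ge> 0" and \<eta>: "\<eta> > 0"
  shows "error_fc \<omega> \<le> error_sc \<omega> + (\<eta> + 1 / n) + (measure (K \<omega>) (bad \<epsilon> \<eta>) + B * \<epsilon>)"
    and "error_sc \<omega> \<le> error_fc \<omega> + (\<eta> + 1 / n) + (measure (K \<omega>) (bad \<epsilon> \<eta>) + B * \<epsilon>)"
proof -
  note shift = miss_sc_shift[OF \<omega> r dens f B \<epsilon>]
  have 1: "measure (K \<omega>) (miss_fc 0 \<alpha>) \<le>
      measure (K \<omega>) (miss_sc 0 (\<alpha> + (\<eta> + 1 / n))) + (measure (K \<omega>) (bad \<epsilon> \<eta>) + B * \<epsilon>)" for \<alpha>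
    using miss_measure_compare(1)[OF \<omega>, of 0 \<alpha> \<epsilon> \<eta>] shift[of 0 "\<alpha> + (\<eta> + 1 / n)"] by linarith
  have 2: "measure (K \<omega>) (miss_sc 0 \<alpha>) \<le>
      measure (K \<omega>) (miss_fc 0 (\<alpha> + (\<eta> + 1 / n))) + (measure (K \<omega>) (bad \<epsilon> \<eta>) + B * \<epsilon>)" for \<alpha>
    using miss_measure_compare(2)[OF \<omega>, of \<epsilon> \<alpha> \<epsilon> \<eta>] shift[of \<epsilon> \<alpha>] by simp
  have nonneg: "0 \<le> \<eta> + 1 / n" "0 \<le> measure (K \<omega>) (bad \<epsilon> \<eta>) + B * \<epsilon>"
    using B \<epsilon> \<eta> by auto
  note bounds = measure_nonneg K_measure_le_1[OF \<omega>]
  show "error_fc \<omega> \<le> error_sc \<omega> + (\<eta> + 1 / n) + (measure (K \<omega>) (bad \<epsilon> \<eta>) + B * \<epsilon>)"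
    unfolding error_fc_def error_sc_def noncoverage_fc[OF \<omega>] noncoverage_sc[OF \<omega>]
    by (intro SUP_error_le bounds nonneg 1 2)
  show "error_sc \<omega> \<le> error_fc \<omega> + (\<eta> + 1 / n) + (measure (K \<omega>) (bad \<epsilon> \<eta>) + B * \<epsilon>)"
    unfolding error_fc_def error_sc_def noncoverage_fc[OF \<omega>] noncoverage_sc[OF \<omega>]
    by (intro SUP_error_le bounds nonneg 1 2)
qed

lemma expectation_le:
  assumes X: "X \<in> borel_measurable M" "\<And>\<omega>. \<omega> \<in> space M \<Longrightarrow> X \<omega> \<in> {0..1::real}"
    and W: "W \<in> borel_measurable M" "\<And>\<omega>. \<omega> \<in> space M \<Longrightarrow> W \<omega> \<in> {0..1::real}"
    and J: "J \<in> borel_measurable M" "\<And>\<omega>. \<omega> \<in> space M \<Longrightarrow> J \<omega> \<in> {0..1::real}"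
    and A: "A \<in> sets M" and e: "e \<ge> 0"
    and le: "AE \<omega> in M. \<omega> \<notin> A \<longrightarrow> X \<omega> \<le> W \<omega> + e + J \<omega>"
  shows "expectation X \<le> expectation W + e + expectation J + prob A"
proof -
  have int: "integrable M g" if "g \<in> borel_measurable M" "\<And>\<omega>. \<omega> \<in> space M \<Longrightarrow> g \<omega> \<in> {0..1::real}" for g
    using that by (intro integrable_const_bound[of _ 1]) auto
  note [simp] = int[OF X] int[OF W] int[OF J]
  have [simp]: "integrable M (indicator A :: _ \<Rightarrow> real)"
    using A by (simp add: emeasure_eq_measure)
  have "expectation X \<le> expectation (\<lambda>\<omega>. W \<omega> + e + J \<omega> + indicator A \<omega>)"
  proof (rule integral_mono_AE)
    show "AE \<omega> in M. X \<omega> \<le> W \<omega> + e + J \<omega> + indicator A \<omega>"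
      using le
    proof (rule AE_mp[OF _ AE_I2], intro impI)
      fix \<omega> assume "\<omega> \<in> space M" "\<omega> \<notin> A \<longrightarrow> X \<omega> \<le> W \<omega> + e + J \<omega>"
      then show "X \<omega> \<le> W \<omega> + e + J \<omega> + indicator A \<omega>"
        using X(2)[of \<omega>] W(2)[of \<omega>] J(2)[of \<omega>] e by (cases "\<omega> \<in> A") auto
    qed
  qed auto
  also have "\<dots> = expectation W + e + expectation J + prob A"
    using A by (simp add: prob_space)
  finally show ?thesis .
qed

text \<open>On the event that the density exceeds \<open>B\<close>, the trivial bound 1 for the errors is used.\<close>

lemma expectation_error_compare:
  assumes dens: "AE \<omega> in M. distributed (K \<omega>) lborel (\<lambda>d. c n (d (n + 1)) (restrict d {1..n}))
          (\<lambda>x. ennreal (f (sample t n \<omega>) x))"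
    and norm: "(\<lambda>\<omega>. SUP x. ereal \<bar>f (sample t n \<omega>) x\<bar>) \<in> borel_measurable M"
    and B: "B \<ge> 0" and \<epsilon>: "\<epsilon> \<ge> 0" and \<eta>: "\<eta> > 0"
  shows "expectation error_fc \<le> expectation error_sc + (\<eta> + 1 / n + B * \<epsilon>) + instability \<epsilon> / \<eta>
      + prob {\<omega> \<in> space M. (SUP x. ereal \<bar>f (sample t n \<omega>) x\<bar>) > ereal B}"
    and "expectation error_sc \<le> expectation error_fc + (\<eta> + 1 / n + B * \<epsilon>) + instability \<epsilon> / \<eta>
      + prob {\<omega> \<in> space M. (SUP x. ereal \<bar>f (sample t n \<omega>) x\<bar>) > ereal B}"
proof -
  define A where "A = {\<omega> \<in> space M. (SUP x. ereal \<bar>f (sample t n \<omega>) x\<bar>) > ereal B}"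
  have A: "A \<in> sets M"
    unfolding A_def using norm by measurable
  have ae: "AE \<omega> in M. \<omega> \<notin> A \<longrightarrow>
      error_fc \<omega> \<le> error_sc \<omega> + (\<eta> + 1 / n + B * \<epsilon>) + measure (K \<omega>) (bad \<epsilon> \<eta>) \<and>
      error_sc \<omega> \<le> error_fc \<omega> + (\<eta> + 1 / n + B * \<epsilon>) + measure (K \<omega>) (bad \<epsilon> \<eta>)"
    using AE_space dens AE_K_sc_score
  proof eventually_elim
    case (elim \<omega>)
    have "f (sample t n \<omega>) x \<le> B" if "\<omega> \<notin> A" for x
    proof -
      have "ereal \<bar>f (sample t n \<omega>) x\<bar> \<le> (SUP x. ereal \<bar>f (sample t n \<omega>) x\<bar>)"
        by (rule SUP_upper) simp
      also have "\<dots> \<le> ereal B"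
        using that elim(1) by (auto simp: A_def not_less)
      finally show ?thesis by simp
    qed
    then show ?case
      using error_compare[OF elim(1) elim(3) elim(2) _ B \<epsilon> \<eta>] by (simp add: algebra_simps)
  qed
  have e: "0 \<le> \<eta> + 1 / n + B * \<epsilon>"
    using B \<epsilon> \<eta> by simp
  note J = measurable_K_measure[OF sets_bad, of \<epsilon> \<eta>]
  have bad: "(\<integral>\<omega>. measure (K \<omega>) (bad \<epsilon> \<eta>) \<partial>M) \<le> instability \<epsilon> / \<eta>"
    using integral_K_bad_le[OF \<eta>] unfolding instability_def .
  have "expectation error_fc \<le> expectation error_sc + (\<eta> + 1 / n + B * \<epsilon>)
      + (\<integral>\<omega>. measure (K \<omega>) (bad \<epsilon> \<eta>) \<partial>M) + prob A"
    by (rule expectation_le[OF measurable_error(1) error_bounds(1) measurable_error(2) error_bounds(2) J _ A e])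
      (use ae in \<open>auto intro: K_measure_le_1\<close>)
  then show "expectation error_fc \<le> expectation error_sc + (\<eta> + 1 / n + B * \<epsilon>) + instability \<epsilon> / \<eta>
      + prob {\<omega> \<in> space M. (SUP x. ereal \<bar>f (sample t n \<omega>) x\<bar>) > ereal B}"
    using bad unfolding A_def by linarith
  have "expectation error_sc \<le> expectation error_fc + (\<eta> + 1 / n + B * \<epsilon>)
      + (\<integral>\<omega>. measure (K \<omega>) (bad \<epsilon> \<eta>) \<partial>M) + prob A"
    by (rule expectation_le[OF measurable_error(2) error_bounds(2) measurable_error(1) error_bounds(1) J _ A e])
      (use ae in \<open>auto intro: K_measure_le_1\<close>)
  then show "expectation error_sc \<le> expectation error_fc + (\<eta> + 1 / n + B * \<epsilon>) + instability \<epsilon> / \<eta>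
      + prob {\<omega> \<in> space M. (SUP x. ereal \<bar>f (sample t n \<omega>) x\<bar>) > ereal B}"
    using bad unfolding A_def by linarith
qed

end

section \<open>Asymptotic equivalence\<close>

lemma tendsto_0_transfer:
  fixes X W :: "nat \<Rightarrow> real"
  assumes W: "W \<longlonglongrightarrow> 0" and X: "\<forall>\<^sub>F n in sequentially. 0 \<le> X n"
    and le: "\<And>e. e > 0 \<Longrightarrow> \<forall>\<^sub>F n in sequentially. X n \<le> W n + e"
  shows "X \<longlonglongrightarrow> 0"
proof (rule tendstoI)
  fix e :: real assume e: "e > 0"
  have "\<forall>\<^sub>F n in sequentially. dist (W n) 0 < e / 2"
    using W e by (intro tendstoD) auto
  moreover have "\<forall>\<^sub>F n in sequentially. X n \<le> W n + e / 2"
    using e by (intro le) auto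
  ultimately show "\<forall>\<^sub>F n in sequentially. dist (X n) 0 < e"
    using X by eventually_elim (auto simp: dist_real_def)
qed

theorem theorem4p2:
  fixes Y :: "nat \<Rightarrow> real set" and p :: "nat \<Rightarrow> nat" and P :: "nat \<Rightarrow> point measure"
    and M :: "nat \<Rightarrow> 'w measure" and t :: "nat \<Rightarrow> nat \<Rightarrow> 'w \<Rightarrow> point"
    and C :: "nat \<Rightarrow> scores" and K :: "nat \<Rightarrow> 'w \<Rightarrow> (nat \<Rightarrow> point) measure"
  assumes "\<And>n. n \<ge> 1 \<Longrightarrow> is_interval (Y n)"
    and "\<And>n. n \<ge> 1 \<Longrightarrow> prob_space (P n)"
    and "\<And>n. n \<ge> 1 \<Longrightarrow> sets (P n) = sets (data_space (Y n) (p n))"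
    and "\<And>n. n \<ge> 1 \<Longrightarrow> regular_measure (P n)"
    and "\<And>n. n \<ge> 1 \<Longrightarrow> prob_space (M n)"
    and "\<And>n. n \<ge> 1 \<Longrightarrow>
      prob_space.indep_vars (M n) (\<lambda>_. data_space (Y n) (p n)) (t n) {1..n + 1}"
    and "\<And>n i. n \<ge> 1 \<Longrightarrow> i \<in> {1..n + 1} \<Longrightarrow> distr (M n) (data_space (Y n) (p n)) (t n i) = P n"
    and "\<And>n. n \<ge> 1 \<Longrightarrow> conformity_scores (data_space (Y n) (p n)) (C n)"
    and "\<And>n. n \<ge> 1 \<Longrightarrow>
      regular_cond_distr (M n)
        (vimage_algebra (space (M n)) (sample (t n) n) (vectors (data_space (Y n) (p n)) n))
        (vectors (data_space (Y n) (p n)) (n + 1)) (sample (t n) (n + 1)) (K n)"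
    and "stable M t C"
  shows
    "((\<forall>\<delta>>0. \<forall>\<epsilon>>0.
         (\<lambda>n. measure (M n) {\<omega> \<in> space (M n).
            (SUP \<alpha>\<in>{0..1}. noncoverage (K n \<omega>) n (PS_fc (Y n) (C n) n \<alpha> \<delta>) - \<alpha>) \<ge> \<epsilon>})
           \<longlonglongrightarrow> 0)
      \<longleftrightarrow>
      (\<forall>\<delta>>0. \<forall>\<epsilon>>0.
         (\<lambda>n. measure (M n) {\<omega> \<in> space (M n).
            (SUP \<alpha>\<in>{0..1}. noncoverage (K n \<omega>) n (PS_sc (Y n) (C n) n \<alpha> \<delta>) - \<alpha>) \<ge> \<epsilon>})
           \<longlonglongrightarrow> 0))
     \<and>
     (continuous_case M t C K \<longrightarrow>
      ((\<lambda>n. \<integral>\<omega>. (SUP \<alpha>\<in>{0..1}. \<bar>noncoverage (K n \<omega>) n (PS_fc (Y n) (C n) n \<alpha> 0) - \<alpha>\<bar>) \<partial>M n)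
         \<longlonglongrightarrow> 0
       \<longleftrightarrow>
       (\<lambda>n. \<integral>\<omega>. (SUP \<alpha>\<in>{0..1}. \<bar>noncoverage (K n \<omega>) n (PS_sc (Y n) (C n) n \<alpha> 0) - \<alpha>\<bar>) \<partial>M n)
         \<longlonglongrightarrow> 0))"
proof -
  note hyps = assms
  have loc: "conformal_sample (M n) n (Y n) (p n) (P n) (t n) (C n) (K n)" if "n \<ge> 2" for n
    using that by (intro conformal_sample.intro conformal_sample_axioms.intro hyps) auto
  define \<beta> where "\<beta> \<epsilon> n = measure (M n) {\<omega> \<in> space (M n).
        \<bar>C n n (t n (n + 1) \<omega>) (sample (t n) n \<omega>) -
         C n (n - 1) (t n (n + 1) \<omega>) (omit n n (sample (t n) n \<omega>))\<bar> \<ge> \<epsilon>}" for \<epsilon> n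
  have \<beta>: "\<beta> \<epsilon> \<longlonglongrightarrow> 0" if "\<epsilon> > 0" for \<epsilon>
    using \<open>stable M t C\<close> that unfolding stable_def \<beta>_def by blast
  have inst: "conformal_sample.instability (M n) n (t n) (C n) \<epsilon> = \<beta> \<epsilon> n" if "n \<ge> 2" for n \<epsilon>
    unfolding conformal_sample.instability_def[OF loc[OF that]] \<beta>_def ..
  have large: "\<forall>\<^sub>F n in sequentially. n \<ge> 2 \<and> 1 / real n \<le> e" if "e > 0" for e :: real
  proof -
    have "\<forall>\<^sub>F n in sequentially. 1 / real n < e"
      using order_tendstoD(2)[OF lim_1_over_n that] by simp
    then show ?thesis
      using eventually_ge_at_top[of 2] by eventually_elim simp
  qed

  define xf where "xf n \<delta> e = measure (M n) {\<omega> \<in> space (M n).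
      (SUP \<alpha>\<in>{0..1}. noncoverage (K n \<omega>) n (PS_fc (Y n) (C n) n \<alpha> \<delta>) - \<alpha>) \<ge> e}" for n \<delta> e
  define xs where "xs n \<delta> e = measure (M n) {\<omega> \<in> space (M n).
      (SUP \<alpha>\<in>{0..1}. noncoverage (K n \<omega>) n (PS_sc (Y n) (C n) n \<alpha> \<delta>) - \<alpha>) \<ge> e}" for n \<delta> e
  have tail: "xf n \<delta> e \<le> xs n (\<delta> - \<epsilon>) (e / 3) + \<beta> \<epsilon> n / \<eta> / (e / 3)"
      "xs n \<delta> e \<le> xf n (\<delta> - \<epsilon>) (e / 3) + \<beta> \<epsilon> n / \<eta> / (e / 3)"
    if "n \<ge> 2" "e > 0" "\<eta> > 0" "\<eta> + 1 / n \<le> e / 3" for n e \<eta> \<epsilon> \<delta>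
    using conformal_sample.excess_tail_compare[OF loc[OF that(1)] that(2-4)]
    unfolding xf_def xs_def inst[OF that(1)]
      conformal_sample.excess_fc_def[OF loc[OF that(1)]] conformal_sample.excess_sc_def[OF loc[OF that(1)]]
    by blast+
  have transfer: "\<forall>\<delta>>0. \<forall>e>0. (\<lambda>n. X n \<delta> e) \<longlonglongrightarrow> 0"
    if W: "\<forall>\<delta>>0. \<forall>e>0. (\<lambda>n. W n \<delta> e) \<longlonglongrightarrow> 0" and X: "\<And>n \<delta> e. 0 \<le> X n \<delta> e"
      and le: "\<And>n e \<eta> \<epsilon> \<delta>. n \<ge> 2 \<Longrightarrow> e > 0 \<Longrightarrow> \<eta> > 0 \<Longrightarrow> \<eta> + 1 / n \<le> e / 3 \<Longrightarrow>
        X n \<delta> e \<le> W n (\<delta> - \<epsilon>) (e / 3) + \<beta> \<epsilon> n / \<eta> / (e / 3)"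
    for X W :: "nat \<Rightarrow> real \<Rightarrow> real \<Rightarrow> real"
  proof (intro allI impI)
    fix \<delta> e :: real assume \<delta>: "\<delta> > 0" and e: "e > 0"
    \<comment> \<open>With a shift of \<open>\<delta> / 2\<close>, half of the inflation is left for \<open>W\<close>,
      and \<open>\<eta> = e / 6\<close> gives \<open>\<eta> + 1/n \<le> e / 3\<close> for large \<open>n\<close>.\<close>
    have "(\<lambda>n. W n (\<delta> - \<delta> / 2) (e / 3) + \<beta> (\<delta> / 2) n / (e / 6) / (e / 3)) \<longlonglongrightarrow> 0 + 0 / (e / 6) / (e / 3)"
      using W \<delta> e by (intro tendsto_intros \<beta>) auto
    then have lim: "(\<lambda>n. W n (\<delta> - \<delta> / 2) (e / 3) + \<beta> (\<delta> / 2) n / (e / 6) / (e / 3)) \<longlonglongrightarrow> 0"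
      by simp
    have up: "\<forall>\<^sub>F n in sequentially. X n \<delta> e \<le>
        W n (\<delta> - \<delta> / 2) (e / 3) + \<beta> (\<delta> / 2) n / (e / 6) / (e / 3)"
    proof (rule eventually_mono[OF large[of "e / 6"]])
      fix n :: nat assume "n \<ge> 2 \<and> 1 / real n \<le> e / 6"
      then show "X n \<delta> e \<le> W n (\<delta> - \<delta> / 2) (e / 3) + \<beta> (\<delta> / 2) n / (e / 6) / (e / 3)"
        using e by (intro le) auto
    qed (use e in simp)
    show "(\<lambda>n. X n \<delta> e) \<longlonglongrightarrow> 0"
      by (rule tendsto_sandwich[OF _ up tendsto_const lim]) (simp add: X)
  qed
  have general: "(\<forall>\<delta>>0. \<forall>e>0. (\<lambda>n. xf n \<delta> e) \<longlonglongrightarrow> 0) \<longleftrightarrow> (\<forall>\<delta>>0. \<forall>e>0. (\<lambda>n. xs n \<delta> e) \<longlonglongrightarrow> 0)"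
  proof
    have pos: "0 \<le> xf n \<delta> e" "0 \<le> xs n \<delta> e" for n \<delta> e
      by (simp_all add: xf_def xs_def)
    show "\<forall>\<delta>>0. \<forall>e>0. (\<lambda>n. xs n \<delta> e) \<longlonglongrightarrow> 0" if "\<forall>\<delta>>0. \<forall>e>0. (\<lambda>n. xf n \<delta> e) \<longlonglongrightarrow> 0"
      using that by (rule transfer) (fact pos(2), rule tail(2))
    show "\<forall>\<delta>>0. \<forall>e>0. (\<lambda>n. xf n \<delta> e) \<longlonglongrightarrow> 0" if "\<forall>\<delta>>0. \<forall>e>0. (\<lambda>n. xs n \<delta> e) \<longlonglongrightarrow> 0"
      using that by (rule transfer) (fact pos(1), rule tail(1))
  qed

  define ef where "ef n = (\<integral>\<omega>. (SUP \<alpha>\<in>{0..1}. \<bar>noncoverage (K n \<omega>) n (PS_fc (Y n) (C n) n \<alpha> 0) - \<alpha>\<bar>) \<partial>M n)" for n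
  define es where "es n = (\<integral>\<omega>. (SUP \<alpha>\<in>{0..1}. \<bar>noncoverage (K n \<omega>) n (PS_sc (Y n) (C n) n \<alpha> 0) - \<alpha>\<bar>) \<partial>M n)" for n
  have ef_eq: "ef n = (\<integral>\<omega>. conformal_sample.error_fc n (Y n) (C n) (K n) \<omega> \<partial>M n)"
    and es_eq: "es n = (\<integral>\<omega>. conformal_sample.error_sc n (Y n) (C n) (K n) \<omega> \<partial>M n)" if "n \<ge> 2" for n
    unfolding ef_def es_def conformal_sample.error_fc_def[OF loc[OF that]] conformal_sample.error_sc_def[OF loc[OF that]] by simp_all
  have nonneg: "ef n \<ge> 0" "es n \<ge> 0" if "n \<ge> 2" for n
    unfolding ef_eq[OF that] es_eq[OF that] using conformal_sample.error_bounds[OF loc[OF that]]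
    by (auto intro!: Bochner_Integration.integral_nonneg_AE AE_I2)
  have continuous: "ef \<longlonglongrightarrow> 0 \<longleftrightarrow> es \<longlonglongrightarrow> 0" if CC: "continuous_case M t C K"
  proof -
    obtain f :: "nat \<Rightarrow> (nat \<Rightarrow> point) \<Rightarrow> real \<Rightarrow> real" where
      dens: "\<forall>n\<ge>1. AE \<omega> in M n. (\<forall>x. 0 \<le> f n (sample (t n) n \<omega>) x) \<and>
        distributed (K n \<omega>) lborel (\<lambda>d. C n n (d (n + 1)) (restrict d {1..n}))
          (\<lambda>x. ennreal (f n (sample (t n) n \<omega>) x))"
      and norm: "\<forall>n\<ge>1. (\<lambda>\<omega>. SUP x. ereal \<bar>f n (sample (t n) n \<omega>) x\<bar>) \<in> borel_measurable (M n)"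
      and bounded: "\<forall>e>0. \<exists>B::real. \<exists>n\<^sub>0. \<forall>n\<ge>n\<^sub>0.
        measure (M n) {\<omega> \<in> space (M n). (SUP x. ereal \<bar>f n (sample (t n) n \<omega>) x\<bar>) > ereal B} < e"
      using CC unfolding continuous_case_def Let_def by (elim exE conjE) (rule that)
    have close: "\<forall>\<^sub>F n in sequentially. ef n \<le> es n + e \<and> es n \<le> ef n + e" if e: "e > 0" for e
    proof -
      define N where "N n \<omega> = (SUP x. ereal \<bar>f n (sample (t n) n \<omega>) x\<bar>)" for n \<omega>
      obtain B0 n0 where B0: "\<And>n. n \<ge> n0 \<Longrightarrow> measure (M n) {\<omega> \<in> space (M n). N n \<omega> > ereal B0} < e / 5"
        using bounded[rule_format, of "e / 5"] e unfolding N_def by auto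
      \<comment> \<open>Each of the four error terms below is at most \<open>e / 5\<close>; the maximum with 1 only makes \<open>B\<close> positive.\<close>
      define B where "B = max B0 1"
      define \<epsilon> where "\<epsilon> = e / (5 * B)"
      have B: "B > 0" "B0 \<le> B" and \<epsilon>: "\<epsilon> > 0" "B * \<epsilon> = e / 5"
        using e by (auto simp: B_def \<epsilon>_def)
      have "\<forall>\<^sub>F n in sequentially. \<beta> \<epsilon> n < e / 10 * (e / 5)"
        using e by (intro order_tendstoD(2)[OF \<beta>[OF \<epsilon>(1)]]) simp
      moreover have "\<forall>\<^sub>F n in sequentially. n \<ge> 2 \<and> 1 / real n \<le> e / 10"
        using e by (intro large) auto
      ultimately show ?thesis
        using eventually_ge_at_top[of n0]
      proof eventually_elim
        case (elim n)
        then have n: "n \<ge> 2" "n \<ge> 1" "n \<ge> n0" by auto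
        interpret S: conformal_sample "M n" n "Y n" "p n" "P n" "t n" "C n" "K n"
          by (rule loc[OF n(1)])
        have dens': "AE \<omega> in M n. distributed (K n \<omega>) lborel (\<lambda>d. C n n (d (n + 1)) (restrict d {1..n}))
          (\<lambda>x. ennreal (f n (sample (t n) n \<omega>) x))"
          using dens[rule_format, OF n(2)] by eventually_elim blast
        have "N n \<in> borel_measurable (M n)"
          using norm[rule_format, OF n(2)] unfolding N_def .
        then have "{\<omega> \<in> space (M n). N n \<omega> > ereal B0} \<in> sets (M n)"
          by measurable
        then have "measure (M n) {\<omega> \<in> space (M n). N n \<omega> > ereal B} \<le>
            measure (M n) {\<omega> \<in> space (M n). N n \<omega> > ereal B0}"
          using B(2) by (intro S.finite_measure_mono) (auto elim!: le_less_trans[rotated])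
        then have tail_N: "measure (M n) {\<omega> \<in> space (M n). N n \<omega> > ereal B} \<le> e / 5"
          using B0[OF n(3)] by linarith
        have "\<beta> \<epsilon> n / (e / 10) \<le> e / 5"
          using elim(1) e by (simp add: field_simps)
        moreover have "ef n \<le> es n + (e / 10 + 1 / n + B * \<epsilon>) + \<beta> \<epsilon> n / (e / 10)
            + measure (M n) {\<omega> \<in> space (M n). N n \<omega> > ereal B}"
          and "es n \<le> ef n + (e / 10 + 1 / n + B * \<epsilon>) + \<beta> \<epsilon> n / (e / 10)
            + measure (M n) {\<omega> \<in> space (M n). N n \<omega> > ereal B}"
          using S.expectation_error_compare[OF dens' norm[rule_format, OF n(2)], of B \<epsilon> "e / 10"] B(1) \<epsilon>(1) e
          unfolding ef_eq[OF n(1)] es_eq[OF n(1)] inst[OF n(1)] N_def by simp_all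
        ultimately show ?case
          using tail_N elim(2) \<epsilon>(2) e by auto
      qed
    qed
    have pos: "\<forall>\<^sub>F n in sequentially. 0 \<le> ef n" "\<forall>\<^sub>F n in sequentially. 0 \<le> es n"
      using nonneg by (auto intro: eventually_mono[OF eventually_ge_at_top[of 2]])
    show ?thesis
    proof
      show "es \<longlonglongrightarrow> 0" if "ef \<longlonglongrightarrow> 0"
        by (rule tendsto_0_transfer[OF that pos(2)]) (auto elim: eventually_mono[OF close])
      show "ef \<longlonglongrightarrow> 0" if "es \<longlonglongrightarrow> 0"
        by (rule tendsto_0_transfer[OF that pos(1)]) (auto elim: eventually_mono[OF close])
    qed
  qed
  show ?thesis
    using general continuous unfolding xf_def xs_def ef_def es_def by blast
qed

end
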